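(* Let $\langle\mathcal{U},\mathcal{S}\rangle$ be an instance of the set splitting problem in simple form, with $\mathcal{U}=\{1,\dots,u\}$ and $\mathcal{S}=\{S^1,\dots,S^s\}$, and let $\Gamma=\langle V,E\rangle$ be the directed graph constructed from it as described in the context. Then the following three properties hold. (i) If no partition of $\mathcal{U}$ into two disjoint non-empty subsets exists that splits all $S^i\in\mathcal{S}$, then $\Gamma$ is non-Hamiltonian. (ii) If a partition $(\mathcal{U}_1,\mathcal{U}_2)$ of $\mathcal{U}$ into two disjoint non-empty subsets exists that splits all $S^i\in\mathcal{S}$, then a corresponding Hamiltonian cycle exists in $\Gamma$, i.e. a Hamiltonian cycle whose corresponding pair (as defined in the context) is $(\mathcal{U}_1,\mathcal{U}_2)$. (iii) From any Hamiltonian cycle in $\Gamma$ one can, in time polynomial in the size of the instance, identify the corresponding pair $(\mathcal{U}_1,\mathcal{U}_2)$, and this pair is a partition of $\mathcal{U}$ that constitutes a solution of the instance $\langle\mathcal{U},\mathcal{S}\rangle$ of the set splitting problem.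
   Context: **Set splitting problem (SSP).** An instance is a finite universe set $\mathcal{U}$ and a family $\mathcal{S}$ of subsets of $\mathcal{U}$. A partition of $\mathcal{U}$ into two disjoint non-empty subsets $\mathcal{U}_1,\mathcal{U}_2$ splits $S\in\mathcal{S}$ if $S$ is contained neither in $\mathcal{U}_1$ nor in $\mathcal{U}_2$. A solution is such a partition that splits every $S\in\mathcal{S}$. **Simple form.** The instance ($\mathcal{U}=\{1,\dots,u\}$ with $u\ge 1$, $\mathcal{S}=\{S^1,\dots,S^s\}$ with the $S^i$ distinct) is in simple form if: no $S^i$ has exactly one element; every element of $\mathcal{U}$ lies in some $S^i$; no $S^i$ equals $\mathcal{U}$; and no $S^i$ is a subset of another $S^j$, $j\neq i$. (It follows that $s\ge1$ and $|S^i|\ge 2$ for all $i$.) The elements of $S^i$ are listed in ascending order as $s^i_1<s^i_2<\dots<s^i_{|S^i|}$. **Hamiltonicity.** A Hamiltonian cycle of a directed graph with $N$ vertices is a simple directed cycle of length $N$; a graph is Hamiltonian if it has one, and non-Hamiltonian otherwise. **Construction of $\Gamma=\langle V,E\rangle$.** The vertices (all distinct) are: $v^{U,i}_1,v^{U,i}_2,v^{U,i}_3,v^{U,i}_4$ for each $i\in\mathcal{U}$; $v^{S,i}_1,\dots,v^{S,i}_{5+6|S^i|}$ for each $i=1,\dots,s$; and $v^C_1,v^C_2$. The directed edges are the following. 1. For each $i\in\mathcal{U}$: $(v^{U,i}_1,v^{U,i}_2)$, $(v^{U,i}_1,v^{U,i}_3)$, $(v^{U,i}_2,v^{U,i}_3)$,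 $(v^{U,i}_3,v^{U,i}_2)$. 2. For each $i=1,\dots,s$, writing $k=|S^i|$, $w_m=v^{S,i}_m$, $a_j=3+3j$, $b_j=4+3j$, $c_j=5+3j$: - Group I: $(w_1,w_6)$, $(w_1,w_{6+3k})$, $(w_{5+3k},w_2)$, $(w_{5+6k},w_2)$, $(w_3,w_4)$, $(w_4,w_3)$, $(w_4,w_5)$, $(w_5,w_4)$. - Group II, for $j=1,\dots,k$: $(w_{a_j},w_{b_j})$, $(w_{b_j},w_{a_j})$, $(w_{b_j},w_{c_j})$, $(w_{c_j},w_{b_j})$, $(w_{a_j+3k},w_{b_j+3k})$, $(w_{b_j+3k},w_{a_j+3k})$, $(w_{b_j+3k},w_{c_j+3k})$, $(w_{c_j+3k},w_{b_j+3k})$. - Group III, for $j=1,\dots,k-1$: $(w_{c_j},w_{c_j+1})$, $(w_{c_j},w_{c_j+1+3k})$, $(w_{c_j+3k},w_{c_j+1})$, $(w_{c_j+3k},w_{c_j+1+3k})$, $(w_{c_j},w_3)$, $(w_3,w_{c_j+1})$, $(w_{c_j+3k},w_5)$, $(w_5,w_{c_j+3k+1})$. 3. Linking edges: $(v^{U,u}_4,v^C_1)$, $(v^C_1,v^{S,1}_1)$, $(v^{S,s}_2,v^C_2)$, $(v^C_2,v^{U,1}_1)$; $(v^{U,i}_4,v^{U,i+1}_1)$ for $i=1,\dots,u-1$; and $(v^{S,j}_2,v^{S,j+1}_1)$ for $j=1,\dots,s-1$. 4. For each $i\in\mathcal{U}$, let $F^i=(F^i_1,\dots,F^i_f)$ be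 the increasing list of the indices of the subsets in $\mathcal{S}$ containing $i$ (so $f=|F^i|$), and let $R^i_j$ be the position of $i$ in the ordered list $S^{F^i_j}$. Put $d_{ij}=3+3R^i_j$ and $e_{ij}=3+3|S^{F^i_j}|+3R^i_j$. The edges are $(v^{U,i}_2,v^{S,F^i_1}_{2+e_{i1}})$, $(v^{S,F^i_f}_{e_{if}},v^{U,i}_4)$, $(v^{U,i}_3,v^{S,F^i_1}_{2+d_{i1}})$, $(v^{S,F^i_f}_{d_{if}},v^{U,i}_4)$, and, for $j=1,\dots,f-1$, $(v^{S,F^i_j}_{e_{ij}},v^{S,F^i_{j+1}}_{2+e_{i,j+1}})$ and $(v^{S,F^i_j}_{d_{ij}},v^{S,F^i_{j+1}}_{2+d_{i,j+1}})$. **Correspondence.** Traverse a Hamiltonian cycle of $\Gamma$ starting from the vertex $v^{U,1}_1$. Its corresponding pair $(\mathcal{U}_1,\mathcal{U}_2)$ is defined by placing $i\in\mathcal{U}$ in $\mathcal{U}_1$ if $v^{U,i}_2$ is visited after $v^{U,i}_3$, and in $\mathcal{U}_2$ if $v^{U,i}_3$ is visited after $v^{U,i}_2$. *)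

theory Defs
  imports "Graph_Theory.Pair_Digraph" "HOL-Computational_Algebra.Polynomial"
begin

section \<open>The set splitting problem\<close>

definition splits :: "'a set \<times> 'a set \<Rightarrow> 'a set \<Rightarrow> bool" where
  "splits P X \<longleftrightarrow> \<not> X \<subseteq> fst P \<and> \<not> X \<subseteq> snd P"

definition two_partition :: "'a set \<Rightarrow> 'a set \<times> 'a set \<Rightarrow> bool" where
  "two_partition U P \<longleftrightarrow>
     fst P \<union> snd P = U \<and> fst P \<inter> snd P = {} \<and> fst P \<noteq> {} \<and> snd P \<noteq> {}"

definition ssp_solution :: "'a set \<Rightarrow> 'a set set \<Rightarrow> 'a set \<times> 'a set \<Rightarrow> bool" where
  "ssp_solution U \<S> P \<longleftrightarrow> two_partition U P \<and> (\<forall>X\<in>\<S>. splits P X)"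

text \<open>
  An instance is given by \<open>u\<close>, \<open>s\<close> and \<open>S\<close>: the universe is \<open>{1..u}\<close> and the family consists of
  \<open>S 1, \<dots>, S s\<close>; values of \<open>S\<close> outside \<open>{1..s}\<close> are irrelevant.
\<close>

definition simple_form :: "nat \<Rightarrow> nat \<Rightarrow> (nat \<Rightarrow> nat set) \<Rightarrow> bool" where
  "simple_form u s S \<longleftrightarrow>
     1 \<le> u \<and> (\<forall>i\<in>{1..s}. S i \<subseteq> {1..u}) \<and> inj_on S {1..s} \<and>
     (\<forall>i\<in>{1..s}. card (S i) \<noteq> 1) \<and>
     (\<forall>x\<in>{1..u}. \<exists>i\<in>{1..s}. x \<in> S i) \<and>
     (\<forall>i\<in>{1..s}. S i \<noteq> {1..u}) \<and>
     (\<forall>i\<in>{1..s}. \<forall>j\<in>{1..s}. i \<noteq> j \<longrightarrow> \<not> S i \<subseteq> S j)"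

definition instance_size :: "nat \<Rightarrow> nat \<Rightarrow> (nat \<Rightarrow> nat set) \<Rightarrow> nat" where
  "instance_size u s S = u + s + (\<Sum>i\<in>{1..s}. card (S i))"


section \<open>Hamiltonian cycles\<close>

definition hamiltonian_cycle :: "'a pair_pre_digraph \<Rightarrow> ('a \<times> 'a) list \<Rightarrow> bool" where
  "hamiltonian_cycle G p \<longleftrightarrow> pre_digraph.cycle (with_proj G) p \<and> length p = card (pverts G)"

definition hamiltonian :: "'a pair_pre_digraph \<Rightarrow> bool" where
  "hamiltonian G \<longleftrightarrow> (\<exists>p. hamiltonian_cycle G p)"


section \<open>The graph of an instance\<close>

text \<open>\<open>VU i m\<close>, \<open>VS i m\<close> and \<open>VC m\<close> stand for $v^{U,i}_m$, $v^{S,i}_m$ and $v^C_m$.\<close>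

datatype vertex = VU nat nat | VS nat nat | VC nat

definition vertices :: "nat \<Rightarrow> nat \<Rightarrow> (nat \<Rightarrow> nat set) \<Rightarrow> vertex set" where
  "vertices u s S =
     (\<Union>i\<in>{1..u}. VU i ` {1..4}) \<union>
     (\<Union>i\<in>{1..s}. VS i ` {1..5 + 6 * card (S i)}) \<union>
     {VC 1, VC 2}"

definition element_edges :: "nat \<Rightarrow> vertex rel" where
  "element_edges i =
     {(VU i 1, VU i 2), (VU i 1, VU i 3), (VU i 2, VU i 3), (VU i 3, VU i 2)}"

definition subset_edges :: "nat \<Rightarrow> nat \<Rightarrow> vertex rel" where
  "subset_edges i k =
     (let w = VS i; a = (\<lambda>j. 3 + 3 * j); b = (\<lambda>j. 4 + 3 * j); c = (\<lambda>j. 5 + 3 * j) in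
       {(w 1, w 6), (w 1, w (6 + 3 * k)), (w (5 + 3 * k), w 2), (w (5 + 6 * k), w 2),
        (w 3, w 4), (w 4, w 3), (w 4, w 5), (w 5, w 4)} \<union>
       (\<Union>j\<in>{1..k}.
         {(w (a j), w (b j)), (w (b j), w (a j)), (w (b j), w (c j)), (w (c j), w (b j)),
          (w (a j + 3 * k), w (b j + 3 * k)), (w (b j + 3 * k), w (a j + 3 * k)),
          (w (b j + 3 * k), w (c j + 3 * k)), (w (c j + 3 * k), w (b j + 3 * k))}) \<union>
       (\<Union>j\<in>{1..<k}.
         {(w (c j), w (c j + 1)), (w (c j), w (c j + 1 + 3 * k)),
          (w (c j + 3 * k), w (c j + 1)), (w (c j + 3 * k), w (c j + 1 + 3 * k)),
          (w (c j), w 3), (w 3, w (c j + 1)),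
          (w (c j + 3 * k), w 5), (w 5, w (c j + 3 * k + 1))}))"

definition linking_edges :: "nat \<Rightarrow> nat \<Rightarrow> vertex rel" where
  "linking_edges u s =
     {(VU u 4, VC 1), (VC 1, VS 1 1), (VS s 2, VC 2), (VC 2, VU 1 1)} \<union>
     (\<Union>i\<in>{1..<u}. {(VU i 4, VU (i + 1) 1)}) \<union>
     (\<Union>j\<in>{1..<s}. {(VS j 2, VS (j + 1) 1)})"

text \<open>The list $F^i$; its entry $F^i_j$ is \<open>occurrences s S i ! (j - 1)\<close>.\<close>

definition occurrences :: "nat \<Rightarrow> (nat \<Rightarrow> nat set) \<Rightarrow> nat \<Rightarrow> nat list" where
  "occurrences s S i = filter (\<lambda>m. i \<in> S m) [1..<Suc s]"

text \<open>The position, counted from 1, of \<open>x\<close> in the ascending list of the elements of \<open>X \<ni> x\<close>.\<close>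

definition position :: "nat set \<Rightarrow> nat \<Rightarrow> nat" where
  "position X x = Suc (length (takeWhile (\<lambda>y. y \<noteq> x) (sorted_list_of_set X)))"

definition membership_edges :: "nat \<Rightarrow> (nat \<Rightarrow> nat set) \<Rightarrow> nat \<Rightarrow> vertex rel" where
  "membership_edges s S i =
     (let f = length (occurrences s S i);
          F = (\<lambda>j. occurrences s S i ! (j - 1));
          R = (\<lambda>j. position (S (F j)) i);
          d = (\<lambda>j. 3 + 3 * R j);
          e = (\<lambda>j. 3 + 3 * card (S (F j)) + 3 * R j) in
       {(VU i 2, VS (F 1) (2 + e 1)), (VS (F f) (e f), VU i 4),
        (VU i 3, VS (F 1) (2 + d 1)), (VS (F f) (d f), VU i 4)} \<union>
       (\<Union>j\<in>{1..<f}.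
         {(VS (F j) (e j), VS (F (j + 1)) (2 + e (j + 1))),
          (VS (F j) (d j), VS (F (j + 1)) (2 + d (j + 1)))}))"

definition edges :: "nat \<Rightarrow> nat \<Rightarrow> (nat \<Rightarrow> nat set) \<Rightarrow> vertex rel" where
  "edges u s S =
     (\<Union>i\<in>{1..u}. element_edges i) \<union>
     (\<Union>i\<in>{1..s}. subset_edges i (card (S i))) \<union>
     linking_edges u s \<union>
     (\<Union>i\<in>{1..u}. membership_edges s S i)"

definition ssp_graph :: "nat \<Rightarrow> nat \<Rightarrow> (nat \<Rightarrow> nat set) \<Rightarrow> vertex pair_pre_digraph" where
  "ssp_graph u s S = \<lparr>pverts = vertices u s S, parcs = edges u s S\<rparr>"


section \<open>The pair corresponding to a Hamiltonian cycle\<close>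

text \<open>The vertices of the closed walk \<open>p\<close> in order of traversal, starting from \<open>VU 1 1\<close>.\<close>

definition traversal :: "(vertex \<times> vertex) list \<Rightarrow> vertex list" where
  "traversal p =
     dropWhile (\<lambda>x. x \<noteq> VU 1 1) (map fst p) @ takeWhile (\<lambda>x. x \<noteq> VU 1 1) (map fst p)"

definition visited_after :: "'a list \<Rightarrow> 'a \<Rightarrow> 'a \<Rightarrow> bool" where
  "visited_after xs x y \<longleftrightarrow> (\<exists>i j. i < j \<and> j < length xs \<and> xs ! i = y \<and> xs ! j = x)"

definition corresponding_pair :: "nat \<Rightarrow> (vertex \<times> vertex) list \<Rightarrow> nat set \<times> nat set" where
  "corresponding_pair u p =
     ({i\<in>{1..u}. visited_after (traversal p) (VU i 2) (VU i 3)},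
      {i\<in>{1..u}. visited_after (traversal p) (VU i 3) (VU i 2)})"


section \<open>A machine model for polynomial time\<close>

text \<open>
  Programs are structured random access programs. The store consists of arrays of natural
  numbers; a program mentions finitely many array names. Every node of an evaluated expression
  and every executed command or test costs one step. Since addition is the only operation that increases numbers, the bit
  length of all numbers computed within \<open>t\<close> steps is at most that of the inputs and the
  constants of the program plus \<open>t\<close>; hence this unit-cost model and Turing machines
  simulate each other with polynomial overhead.
\<close>

type_synonym store = "nat \<Rightarrow> nat \<Rightarrow> nat"

datatype expr = Const nat | Get nat expr | Add expr expr | Sub expr expr

datatype test = Eq expr expr | Less expr expr

datatype prog =
    Skip
  | Put nat expr expr
  | Seq prog prog
  | Cond test prog prog
  | While test prog

text \<open>\<open>Sub\<close> is truncated subtraction.\<close>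

primrec eval_expr :: "expr \<Rightarrow> store \<Rightarrow> nat" where
  "eval_expr (Const n) \<sigma> = n"
| "eval_expr (Get x e) \<sigma> = \<sigma> x (eval_expr e \<sigma>)"
| "eval_expr (Add e e') \<sigma> = eval_expr e \<sigma> + eval_expr e' \<sigma>"
| "eval_expr (Sub e e') \<sigma> = eval_expr e \<sigma> - eval_expr e' \<sigma>"

primrec cost_expr :: "expr \<Rightarrow> nat" where
  "cost_expr (Const n) = 1"
| "cost_expr (Get x e) = 1 + cost_expr e"
| "cost_expr (Add e e') = 1 + cost_expr e + cost_expr e'"
| "cost_expr (Sub e e') = 1 + cost_expr e + cost_expr e'"

primrec eval_test :: "test \<Rightarrow> store \<Rightarrow> bool" where
  "eval_test (Eq e e') \<sigma> \<longleftrightarrow> eval_expr e \<sigma> = eval_expr e' \<sigma>"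
| "eval_test (Less e e') \<sigma> \<longleftrightarrow> eval_expr e \<sigma> < eval_expr e' \<sigma>"

primrec cost_test :: "test \<Rightarrow> nat" where
  "cost_test (Eq e e') = 1 + cost_expr e + cost_expr e'"
| "cost_test (Less e e') = 1 + cost_expr e + cost_expr e'"

text \<open>
  \<open>exec c \<sigma> t \<tau>\<close>: started in \<open>\<sigma>\<close>, program \<open>c\<close> halts after \<open>t\<close> steps in \<open>\<tau>\<close>.
  \<open>Put x e e'\<close> stores the value of \<open>e'\<close> in array \<open>x\<close> at the index given by \<open>e\<close>.
\<close>

inductive exec :: "prog \<Rightarrow> store \<Rightarrow> nat \<Rightarrow> store \<Rightarrow> bool" where
  skip: "exec Skip \<sigma> 1 \<sigma>"
| put: "exec (Put x e e') \<sigma> (1 + cost_expr e + cost_expr e')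
          (\<sigma>(x := (\<sigma> x)(eval_expr e \<sigma> := eval_expr e' \<sigma>)))"
| seq: "exec c \<sigma> t \<tau> \<Longrightarrow> exec c' \<tau> t' \<rho> \<Longrightarrow> exec (Seq c c') \<sigma> (1 + t + t') \<rho>"
| cond_true: "eval_test b \<sigma> \<Longrightarrow> exec c \<sigma> t \<tau> \<Longrightarrow> exec (Cond b c c') \<sigma> (1 + cost_test b + t) \<tau>"
| cond_false:
    "\<not> eval_test b \<sigma> \<Longrightarrow> exec c' \<sigma> t \<tau> \<Longrightarrow> exec (Cond b c c') \<sigma> (1 + cost_test b + t) \<tau>"
| while_false: "\<not> eval_test b \<sigma> \<Longrightarrow> exec (While b c) \<sigma> (1 + cost_test b) \<sigma>"
| while_true:
    "eval_test b \<sigma> \<Longrightarrow> exec c \<sigma> t \<tau> \<Longrightarrow> exec (While b c) \<tau> t' \<rho> \<Longrightarrow>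
     exec (While b c) \<sigma> (1 + cost_test b + t + t') \<rho>"

lemma exec_deterministic:
  "exec c \<sigma> t \<tau> \<Longrightarrow> exec c \<sigma> t' \<tau>' \<Longrightarrow> t' = t \<and> \<tau>' = \<tau>"
proof (induction arbitrary: t' \<tau>' rule: exec.induct)
  case (skip \<sigma>)
  then show ?case by cases simp
next
  case (put x e e' \<sigma>)
  then show ?case by cases simp
next
  case (seq c \<sigma> t \<tau> c' t1 \<rho>)
  note IH = seq.IH
  from seq.prems show ?case
  proof cases
    case (seq r \<tau>'' r1)
    with IH(1) have "r = t" "\<tau>'' = \<tau>" by blast+
    with seq IH(2)[of r1 \<tau>'] show ?thesis by simp
  qed
next
  case (cond_true b \<sigma> c t \<tau> c')
  note IH = cond_true.IH and hyps = cond_true.hyps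
  from cond_true.prems show ?case
  proof cases
    case (cond_true r)
    with IH[of r \<tau>'] show ?thesis by simp
  next
    case cond_false
    with hyps show ?thesis by simp
  qed
next
  case (cond_false b \<sigma> c' t \<tau> c)
  note IH = cond_false.IH and hyps = cond_false.hyps
  from cond_false.prems show ?case
  proof cases
    case cond_true
    with hyps show ?thesis by simp
  next
    case (cond_false r)
    with IH[of r \<tau>'] show ?thesis by simp
  qed
next
  case (while_false b \<sigma> c)
  from while_false.prems show ?case
    by cases (simp_all add: while_false.hyps)
next
  case (while_true b \<sigma> c t \<tau> t1 \<rho>)
  note IH = while_true.IH and hyps = while_true.hyps
  from while_true.prems show ?case
  proof cases
    case while_false
    with hyps show ?thesis by simp
  next
    case (while_true r \<tau>'' r1)
    with IH(1) have "r = t" "\<tau>'' = \<tau>" by blast+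
    with while_true IH(2)[of r1 \<tau>'] show ?thesis by simp
  qed
qed


subsection \<open>Input and output\<close>

definition encode_instance :: "nat \<Rightarrow> nat \<Rightarrow> (nat \<Rightarrow> nat set) \<Rightarrow> nat list" where
  "encode_instance u s S =
     [u, s] @ concat (map (\<lambda>i. card (S i) # sorted_list_of_set (S i)) [1..<Suc s])"

fun encode_vertex :: "vertex \<Rightarrow> nat list" where
  "encode_vertex (VU i m) = [0, i, m]"
| "encode_vertex (VS i m) = [1, i, m]"
| "encode_vertex (VC m) = [2, 0, m]"

definition encode_cycle :: "(vertex \<times> vertex) list \<Rightarrow> nat list" where
  "encode_cycle p = length p # concat (map encode_vertex (map fst p))"

text \<open>The input is placed in array 0; the output is read off from array 1.\<close>

definition initial_store :: "nat list \<Rightarrow> store" where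
  "initial_store xs = (\<lambda>x n. if x = 0 \<and> n < length xs then xs ! n else 0)"

definition output_pair :: "nat \<Rightarrow> store \<Rightarrow> nat set \<times> nat set" where
  "output_pair u \<tau> = ({i\<in>{1..u}. \<tau> 1 i = 1}, {i\<in>{1..u}. \<tau> 1 i = 2})"

text \<open>Only uniform algorithms count: one program and one polynomial serve all instances.\<close>

definition identifies_pair_in_time :: "prog \<Rightarrow> nat poly \<Rightarrow> bool" where
  "identifies_pair_in_time c q \<longleftrightarrow>
     (\<forall>u s S p. simple_form u s S \<longrightarrow> hamiltonian_cycle (ssp_graph u s S) p \<longrightarrow>
        (\<exists>t \<tau>. exec c (initial_store (encode_instance u s S @ encode_cycle p)) t \<tau> \<and>
               t \<le> poly q (instance_size u s S) \<and>
               output_pair u \<tau> = corresponding_pair u p))"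

end

theory Submission
  imports Defs
begin

text \<open>
  The middle vertex of a triple in a set gadget is adjacent only to the two outer ones, in both
  directions, so a Hamiltonian cycle runs through the triple in one of two directions: forward,
  as part of the path through the set gadget, or backward, as part of the chain of an element. The
  order in which $v^{U,i}_2$ and $v^{U,i}_3$ are visited decides which row of triples of element
  \<open>i\<close> is backward, and this decision propagates along the chain through all sets containing \<open>i\<close>; the
  other row is forward. The three vertices $v^{S,m}_3,v^{S,m}_4,v^{S,m}_5$ can only be passed
  between a forward triple of one row and a forward triple of the other row, hence the
  \<open>m\<close>-th set is split. This uses only that the cycle gives every vertex one predecessor
  and one successor and contains no 2-cycle.

  Conversely, a solution prescribes all directions, and the three vertices are inserted where two
  consecutive elements of the set lie in different parts. The resulting closed walk meets every
  vertex, and since its length is the number of vertices it meets none twice.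
\<close>

section \<open>Hamiltonian cycles as vertex lists\<close>

lemma pcas_vertices: "pcas x p y \<Longrightarrow> map fst p @ [y] = x # map snd p"
  by (induction p arbitrary: x) auto

lemma pawalk_verts_conv: "pawalk_verts x p = (if p = [] then [x] else map fst p @ [snd (last p)])"
  by (induction p arbitrary: x) auto

text \<open>Consecutive arcs share a vertex, so the heads of a closed walk are its tails shifted
  cyclically. Distinct tails, as many as there are vertices, exhaust the finite vertex set.\<close>

lemma hamiltonian_cycleD:
  assumes "hamiltonian_cycle G p" "finite (pverts G)" "parcs G \<subseteq> pverts G \<times> pverts G"
  shows "p \<noteq> []" "set p \<subseteq> parcs G" "distinct (map fst p)" "set (map fst p) = pverts G"
    "map snd p = rotate1 (map fst p)"
proof -
  obtain x where x: "set p \<subseteq> parcs G" "pcas x p x" "distinct (tl (pawalk_verts x p))"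
    and ne: "p \<noteq> []" and len: "length p = card (pverts G)"
    using assms(1) by (auto simp: hamiltonian_cycle_def pre_digraph.cycle_def pre_digraph.awalk_def
        cas_with_proj_eq awalk_verts_with_proj_eq)
  have *: "map fst p @ [x] = x # map snd p"
    using x(2) by (rule pcas_vertices)
  then have hd: "hd (map fst p) = x" and sn: "map snd p = tl (map fst p) @ [x]"
    using ne by (cases p; auto)+
  have "last (map snd p) = x"
    using sn by simp
  then have "snd (last p) = x"
    using ne last_map[of p snd] by simp
  \<comment> \<open>The distinctness condition of a cycle leaves out the start vertex, and what
    remains are the heads.\<close>
  then have "tl (pawalk_verts x p) = map snd p"
    using ne sn by (simp add: pawalk_verts_conv)
  then have d: "distinct (map snd p)"
    using x(3) by simp
  show rot: "map snd p = rotate1 (map fst p)"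
    using sn hd ne by (cases p) auto
  show dist: "distinct (map fst p)"
    using d rot by (metis distinct1_rotate)
  have sub: "set (map fst p) \<subseteq> pverts G"
    using x(1) assms(3) by auto
  have "card (set (map fst p)) = card (pverts G)"
    using len dist by (metis distinct_card length_map)
  then show "set (map fst p) = pverts G"
    using sub assms(2) by (simp add: card_subset_eq)
  show "p \<noteq> []" "set p \<subseteq> parcs G" by fact+
qed

lemma pcas_zip:
  "xs \<noteq> [] \<Longrightarrow> pcas (hd xs) (zip xs (tl xs @ [y])) y"
proof (induction xs)
  case (Cons x xs)
  then show ?case by (cases xs) auto
qed simp

text \<open>Pairing each vertex with its cyclic successor gives the arc list, so a cycle can be
  built as a plain list of vertices.\<close>

lemma hamiltonian_cycleI:
  assumes "distinct xs" "set xs = pverts G" "xs \<noteq> []"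
    and "set (zip xs (rotate1 xs)) \<subseteq> parcs G"
  shows "hamiltonian_cycle G (zip xs (rotate1 xs))"
proof -
  let ?p = "zip xs (rotate1 xs)"
  have ne: "?p \<noteq> []" using assms(3) by auto
  have r: "rotate1 xs = tl xs @ [hd xs]" using assms(3) by (cases xs) auto
  have c: "pcas (hd xs) ?p (hd xs)"
    unfolding r by (rule pcas_zip) fact
  have "map snd ?p = rotate1 xs" by simp
  then have "last (map snd ?p) = hd xs" using r by simp
  then have "snd (last ?p) = hd xs" using last_map[OF ne, of snd] by metis
  then have "tl (pawalk_verts (hd xs) ?p) = rotate1 xs"
    using ne r assms(3) by (simp add: pawalk_verts_conv)
  then have "pre_digraph.cycle (with_proj G) ?p"
    using assms c ne hd_in_set[OF assms(3)]
    by (auto simp: pre_digraph.cycle_def pre_digraph.awalk_def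
        cas_with_proj_eq awalk_verts_with_proj_eq intro!: exI[of _ "hd xs"])
  moreover have "length ?p = card (pverts G)"
    using assms(1,2) by (metis distinct_card length_rotate1 length_zip min.idem)
  ultimately show ?thesis by (simp add: hamiltonian_cycle_def)
qed

text \<open>Opposite arcs would make two positions cyclic successors of each other, which forces a
  length of at most 2.\<close>

lemma rotate1_no_two_cycle:
  assumes "distinct xs" "3 \<le> length xs" "(x, y) \<in> set (zip xs (rotate1 xs))"
  shows "(y, x) \<notin> set (zip xs (rotate1 xs))"
proof
  let ?n = "length xs"
  assume "(y, x) \<in> set (zip xs (rotate1 xs))"
  then obtain j where j: "j < ?n" "xs ! j = y" "xs ! (Suc j mod ?n) = x"
    by (auto simp: in_set_zip nth_rotate1)
  obtain i where i: "i < ?n" "xs ! i = x" "xs ! (Suc i mod ?n) = y"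
    using assms(3) by (auto simp: in_set_zip nth_rotate1)
  have ne: "0 < ?n" using assms(2) by linarith
  have "Suc j mod ?n = i" "Suc i mod ?n = j"
    using i j assms(1) ne by (metis distinct_conv_nth mod_less_divisor)+
  then have "i = (if Suc j = ?n then 0 else Suc j)" "j = (if Suc i = ?n then 0 else Suc i)"
    using i(1) j(1) by (auto simp: mod_Suc)
  then have "Suc j = ?n \<and> i = 0 \<or> i = Suc j" "Suc i = ?n \<and> j = 0 \<or> j = Suc i"
    by metis+
  then show False using assms(2) by linarith
qed

section \<open>Order of visits along a cycle\<close>

lemma traversal_conv_rotate:
  "traversal p = rotate (length (takeWhile (\<lambda>x. x \<noteq> VU 1 1) (map fst p))) (map fst p)"
  unfolding traversal_def
  by (metis rotate_append takeWhile_dropWhile_id)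

text \<open>The traversal starts at \<open>VU 1 1\<close>, so only the arc entering
  \<open>VU 1 1\<close> joins the end of the list to its beginning; for every other arc the head
  comes right behind the tail.\<close>

lemma visited_after_arc:
  assumes "(x, y) \<in> set p" "y \<noteq> VU 1 1" "VU 1 1 \<in> set (map fst p)"
    and "map snd p = rotate1 (map fst p)"
  shows "visited_after (traversal p) y x"
proof -
  define n where "n = length (takeWhile (\<lambda>x. x \<noteq> VU 1 1) (map fst p))"
  let ?q = "rotate n p" and ?t = "traversal p"
  have t: "?t = rotate n (map fst p)"
    by (simp add: traversal_conv_rotate n_def)
  have fq: "map fst ?q = ?t" by (simp add: t rotate_map)
  have sq: "map snd ?q = rotate1 ?t"
    unfolding t rotate_map[symmetric] assms(4) by (simp add: rotate1_rotate_swap)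
  have "dropWhile (\<lambda>x. x \<noteq> VU 1 1) (map fst p) \<noteq> []"
    using assms(3) unfolding dropWhile_eq_Nil_conv by blast
  then have hd: "hd ?t = VU 1 1" and ne: "?t \<noteq> []"
    unfolding traversal_def using hd_dropWhile[of "\<lambda>x. x \<noteq> VU 1 1" "map fst p"] by auto
  have "(x, y) \<in> set ?q" using assms(1) by simp
  then obtain j where j: "j < length ?q" "?q ! j = (x, y)"
    by (metis in_set_conv_nth)
  have len: "length ?t = length ?q" by (simp add: t)
  have x: "?t ! j = x" using j fq by (metis fst_conv nth_map)
  have "rotate1 ?t ! j = y" using j sq by (metis snd_conv nth_map)
  then have y: "?t ! (Suc j mod length ?t) = y"
    using j len by (simp add: nth_rotate1)
  have "Suc j \<noteq> length ?t"
    using y hd ne assms(2) by (auto simp: hd_conv_nth)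
  then have "Suc j < length ?t" using j len by simp
  then show ?thesis
    unfolding visited_after_def using x y by (intro exI[of _ j] exI[of _ "Suc j"]) auto
qed

lemma visited_after_asym:
  assumes "distinct xs" "visited_after xs x y"
  shows "\<not> visited_after xs y x"
  using assms unfolding visited_after_def
  by (metis less_trans nth_eq_iff_index_eq order_less_asym)

lemma distinct_traversal: "distinct (map fst p) \<Longrightarrow> distinct (traversal p)"
  by (simp add: traversal_conv_rotate)


section \<open>The arcs of the graph\<close>

text \<open>Indexing the ascending list at \<open>position X x - 1\<close> recovers
  \<open>x\<close>, whence injectivity; \<open>card X\<close> distinct values between 1 and
  \<open>card X\<close> then exhaust this range.\<close>

lemma
  assumes "finite X"
  shows position_bounds: "x \<in> X \<Longrightarrow> 1 \<le> position X x \<and> position X x \<le> card X"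
    and inj_on_position: "inj_on (position X) X"
    and position_image: "position X ` X = {1..card X}"
proof -
  let ?xs = "sorted_list_of_set X"
  have len: "length ?xs = card X" and set: "set ?xs = X" using assms by auto
  have lt: "length (takeWhile (\<lambda>y. y \<noteq> x) ?xs) < length ?xs" if "x \<in> X" for x
  proof -
    let ?P = "\<lambda>y. y \<noteq> x"
    have "dropWhile ?P ?xs \<noteq> []"
      using that set unfolding dropWhile_eq_Nil_conv by blast
    moreover have "length (takeWhile ?P ?xs) + length (dropWhile ?P ?xs) = length ?xs"
      unfolding length_append[symmetric] takeWhile_dropWhile_id ..
    ultimately show ?thesis by (metis length_greater_0_conv less_add_same_cancel1)
  qed
  then show bounds: "1 \<le> position X x \<and> position X x \<le> card X" if "x \<in> X" for x
    using that unfolding len position_def by (simp add: Suc_leI)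
  have nth: "?xs ! (position X x - 1) = x" if "x \<in> X" for x
    using nth_length_takeWhile[OF lt[OF that]] by (simp add: position_def)
  then show inj: "inj_on (position X) X"
    by (metis inj_onI)
  have "position X ` X \<subseteq> {1..card X}" using bounds by auto
  then show "position X ` X = {1..card X}"
    using card_image[OF inj] by (intro card_subset_eq) auto
qed

text \<open>In the gadget of the \<open>m\<close>-th set, \<open>va m j\<close>, \<open>vb m j\<close>, \<open>vc m j\<close> form a triple for each
  \<open>j < 2k\<close>: the first \<open>k\<close> triples make up the upper row, the others the lower row. Unlike in
  \<^term>\<open>subset_edges\<close>, triples are counted from 0.\<close>

definition va :: "nat \<Rightarrow> nat \<Rightarrow> vertex" where "va m j = VS m (6 + 3 * j)"
definition vb :: "nat \<Rightarrow> nat \<Rightarrow> vertex" where "vb m j = VS m (7 + 3 * j)"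
definition vc :: "nat \<Rightarrow> nat \<Rightarrow> vertex" where "vc m j = VS m (8 + 3 * j)"

text \<open>The triple of element \<open>i\<close> in the \<open>m\<close>-th set and row \<open>r\<close>, where \<open>True\<close> is the lower row,
  and the vertex of the gadget of \<open>i\<close> from which this row is entered.\<close>

definition slot :: "(nat \<Rightarrow> nat set) \<Rightarrow> bool \<Rightarrow> nat \<Rightarrow> nat \<Rightarrow> nat" where
  "slot S r m i = (if r then card (S m) else 0) + (position (S m) i - 1)"

definition port :: "bool \<Rightarrow> nat \<Rightarrow> vertex" where
  "port r i = VU i (if r then 2 else 3)"

lemma abc_inject [simp]:
  "va m j = va m' j' \<longleftrightarrow> m = m' \<and> j = j'" "vb m j = vb m' j' \<longleftrightarrow> m = m' \<and> j = j'"
  "vc m j = vc m' j' \<longleftrightarrow> m = m' \<and> j = j'"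
  by (auto simp: va_def vb_def vc_def)

text \<open>The three kinds of vertices have numbers with different remainders modulo 3.\<close>

lemma abc_distinct [simp]:
  "va m j \<noteq> vb m' j'" "va m j \<noteq> vc m' j'" "vb m j \<noteq> va m' j'" "vb m j \<noteq> vc m' j'"
  "vc m j \<noteq> va m' j'" "vc m j \<noteq> vb m' j'"
proof -
  have "6 + 3 * j \<noteq> 7 + 3 * j'" "6 + 3 * j \<noteq> 8 + 3 * j'" "7 + 3 * j \<noteq> 8 + 3 * j'" for j j' :: nat
    by presburger+
  then show "va m j \<noteq> vb m' j'" "va m j \<noteq> vc m' j'" "vb m j \<noteq> va m' j'" "vb m j \<noteq> vc m' j'"
    "vc m j \<noteq> va m' j'" "vc m j \<noteq> vb m' j'"
    unfolding va_def vb_def vc_def by (metis vertex.inject(2))+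
qed

lemma abc_port_distinct [simp]:
  "va m j \<noteq> VU i l" "vb m j \<noteq> VU i l" "vc m j \<noteq> VU i l"
  "va m j \<noteq> VC l" "vb m j \<noteq> VC l" "vc m j \<noteq> VC l"
  "VU i l \<noteq> va m j" "VU i l \<noteq> vb m j" "VU i l \<noteq> vc m j"
  "VC l \<noteq> va m j" "VC l \<noteq> vb m j" "VC l \<noteq> vc m j"
  "va m j \<noteq> port r i" "vb m j \<noteq> port r i" "vc m j \<noteq> port r i"
  "port r i \<noteq> va m j" "port r i \<noteq> vb m j" "port r i \<noteq> vc m j"
  "port r i \<noteq> VS m l" "VS m l \<noteq> port r i" "port r i \<noteq> VC l" "VC l \<noteq> port r i"
  by (auto simp: va_def vb_def vc_def port_def)

lemma abc_low_distinct [simp]: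
  assumes "l < 6"
  shows "va m j \<noteq> VS m' l" "vb m j \<noteq> VS m' l" "vc m j \<noteq> VS m' l"
    "VS m' l \<noteq> va m j" "VS m' l \<noteq> vb m j" "VS m' l \<noteq> vc m j"
  using assms by (auto simp: va_def vb_def vc_def)

lemma port_inject [simp]: "port r i = port r' i' \<longleftrightarrow> r = r' \<and> i = i'"
  by (auto simp: port_def)

section \<open>Consequences of the simple form, and the arcs in terms of triples\<close>

locale simple_instance =
  fixes u s :: nat and S :: "nat \<Rightarrow> nat set"
  assumes simple: "simple_form u s S"
begin

abbreviation "occ \<equiv> occurrences s S"
abbreviation "E \<equiv> edges u s S"

lemma universe_nonempty: "1 \<le> u"
  using simple by (simp add: simple_form_def)

lemma covered: "i \<in> {1..u} \<Longrightarrow> \<exists>m\<in>{1..s}. i \<in> S m"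
  using simple unfolding simple_form_def by blast

lemma no_inclusion: "m \<in> {1..s} \<Longrightarrow> m' \<in> {1..s} \<Longrightarrow> m \<noteq> m' \<Longrightarrow> \<not> S m \<subseteq> S m'"
  using simple unfolding simple_form_def by blast

lemma subset_universe: "m \<in> {1..s} \<Longrightarrow> S m \<subseteq> {1..u}"
  using simple by (auto simp: simple_form_def)

lemma finite_set: "m \<in> {1..s} \<Longrightarrow> finite (S m)"
  using subset_universe finite_subset by blast

lemma set_occ: "set (occ i) = {m \<in> {1..s}. i \<in> S m}"
  by (auto simp: occurrences_def)

lemma distinct_occ: "distinct (occ i)"
  by (simp add: occurrences_def)

lemma occ_nonempty: "i \<in> {1..u} \<Longrightarrow> occ i \<noteq> []"
proof -
  assume "i \<in> {1..u}"
  then obtain m where "m \<in> {1..s}" "i \<in> S m"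
    using covered by blast
  then show ?thesis using set_occ[of i] by auto
qed

lemma nth_occ: "q < length (occ i) \<Longrightarrow> occ i ! q \<in> {1..s} \<and> i \<in> S (occ i ! q)"
  using set_occ[of i] nth_mem[of q "occ i"] by auto

text \<open>The ban on inclusions excludes the empty set: element 1 lies in some set, which would
  differ from the empty one and include it.\<close>

lemma card_ge_2:
  assumes "m \<in> {1..s}" shows "2 \<le> card (S m)"
proof -
  have "S m \<noteq> {}"
  proof
    assume "S m = {}"
    obtain j where "j \<in> {1..s}" "1 \<in> S j"
      using covered[of 1] universe_nonempty by auto
    with \<open>S m = {}\<close> show False
      using no_inclusion[OF assms, of j] by auto
  qed
  moreover have "card (S m) \<noteq> 1" using simple assms by (auto simp: simple_form_def)
  moreover have "card (S m) \<noteq> 0" using \<open>S m \<noteq> {}\<close> finite_set[OF assms] by simp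
  ultimately show ?thesis by linarith
qed

lemma slot_less:
  "m \<in> {1..s} \<Longrightarrow> i \<in> S m \<Longrightarrow> slot S r m i < 2 * card (S m)"
  using position_bounds[OF finite_set, of m i] by (auto simp: slot_def)

text \<open>\<open>position (S m) i - 1\<close> stays below \<open>card (S m)\<close>, so the two
  rows occupy disjoint ranges, and within a row positions are injective.\<close>

lemma slot_inject:
  assumes "m \<in> {1..s}" "i \<in> S m" "i' \<in> S m"
  shows "slot S r m i = slot S r' m i' \<longleftrightarrow> r = r' \<and> i = i'"
proof -
  note fin = finite_set[OF assms(1)]
  have "position (S m) i = position (S m) i' \<longleftrightarrow> i = i'"
    using inj_on_position[OF fin] assms by (simp add: inj_on_eq_iff)
  then show ?thesis
    using position_bounds[OF fin assms(2)] position_bounds[OF fin assms(3)]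
    by (auto simp: slot_def)
qed

text \<open>One element serves both rows: triples \<open>j\<close> and \<open>card (S m) + j\<close>
  form the column of the element at position \<open>Suc j\<close>.\<close>

lemma slot_surj:
  assumes "m \<in> {1..s}" "j < card (S m)"
  obtains i where "i \<in> S m" "\<And>r. slot S r m i = (if r then card (S m) else 0) + j"
proof -
  have "Suc j \<in> position (S m) ` S m"
    using assms position_image[OF finite_set[OF assms(1)]] by auto
  then show thesis using that by (force simp: slot_def)
qed

text \<open>Quantifying over \<open>r\<close> treats both chains of an element at once. A chain
  enters a triple at \<open>vc\<close> and leaves it at \<open>va\<close>, against the direction of
  the set gadget.\<close>

lemma membership_edges_iff:
  assumes "i \<in> {1..u}"
  shows "(x, y) \<in> membership_edges s S i \<longleftrightarrow>
    (\<exists>r. x = port r i \<and> y = vc (occ i ! 0) (slot S r (occ i ! 0) i)) \<or>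
    (\<exists>r. x = va (last (occ i)) (slot S r (last (occ i)) i) \<and> y = VU i 4) \<or>
    (\<exists>r q. Suc q < length (occ i) \<and> x = va (occ i ! q) (slot S r (occ i ! q) i) \<and>
       y = vc (occ i ! Suc q) (slot S r (occ i ! Suc q) i))"
proof -
  let ?f = "length (occ i)"
  have I: "{1..<?f} = Suc ` {..<?f - 1}"
    by (auto simp: image_Suc_lessThan)
  have l: "last (occ i) = occ i ! (?f - 1)"
    using occ_nonempty[OF assms] by (simp add: last_conv_nth)
  \<comment> \<open>\<open>position\<close> is a successor, so the subtraction in
    \<open>slot\<close> does not truncate.\<close>
  have v: "VS m (3 + 3 * position (S m) i) = va m (slot S False m i)"
    "VS m (3 + 3 * card (S m) + 3 * position (S m) i) = va m (slot S True m i)"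
    "VS m (2 + (3 + 3 * position (S m) i)) = vc m (slot S False m i)"
    "VS m (2 + (3 + 3 * card (S m) + 3 * position (S m) i)) = vc m (slot S True m i)" for m
    by (simp_all add: va_def vc_def slot_def position_def)
  show ?thesis
    unfolding membership_edges_def Let_def l ex_bool_eq I v
    by (simp add: port_def less_diff_conv Bex_def ex_disj_distrib conj_disj_distribL disj_ac)
qed

lemma edges_iff:
  "(x, y) \<in> E \<longleftrightarrow> (\<exists>i\<in>{1..u}. (x, y) \<in> element_edges i) \<or>
     (\<exists>i\<in>{1..s}. (x, y) \<in> subset_edges i (card (S i))) \<or> (x, y) \<in> linking_edges u s \<or>
     (\<exists>i\<in>{1..u}. (x, y) \<in> membership_edges s S i)"
  by (auto simp: edges_def)

end

text \<open>Shifting the index by one turns all vertex numbers of the construction from 6 on into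
  \<open>va\<close>, \<open>vb\<close> and \<open>vc\<close>; \<open>1 \<le> k\<close> keeps
  \<open>k - 1\<close> and \<open>2 * k - 1\<close> from truncating.\<close>

lemma subset_edges_iff:
  assumes "1 \<le> k"
  shows "(x, y) \<in> subset_edges m k \<longleftrightarrow>
    (x, y) \<in> {(VS m 1, va m 0), (VS m 1, va m k), (vc m (k - 1), VS m 2), (vc m (2 * k - 1), VS m 2),
       (VS m 3, VS m 4), (VS m 4, VS m 3), (VS m 4, VS m 5), (VS m 5, VS m 4)} \<or>
    (\<exists>j<k. (x, y) \<in>
       {(va m j, vb m j), (vb m j, va m j), (vb m j, vc m j), (vc m j, vb m j),
        (va m (j + k), vb m (j + k)), (vb m (j + k), va m (j + k)),
        (vb m (j + k), vc m (j + k)), (vc m (j + k), vb m (j + k))}) \<or>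
    (\<exists>j. Suc j < k \<and>
      (x, y) \<in> {vc m j, vc m (j + k)} \<times> {va m (Suc j), va m (Suc (j + k))} \<union>
        {(vc m j, VS m 3), (VS m 3, va m (Suc j)), (vc m (j + k), VS m 5),
         (VS m 5, va m (Suc (j + k)))})"
proof -
  have I: "{1..k} = Suc ` {..<k}" "{1..<k} = Suc ` {..<k - 1}"
    by (auto simp: image_Suc_lessThan)
  have U: "(\<Union>j\<in>Suc ` A. f j) = (\<Union>j\<in>A. f (Suc j))" for A and f :: "nat \<Rightarrow> vertex rel"
    by auto
  have v: "VS m 6 = va m 0" "VS m (6 + 3 * k) = va m k" "VS m (5 + 3 * k) = vc m (k - 1)"
    "VS m (5 + 6 * k) = vc m (2 * k - 1)"
    using assms by (auto simp: va_def vc_def)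
  have w: "VS m (3 + 3 * Suc j) = va m j" "VS m (4 + 3 * Suc j) = vb m j"
    "VS m (5 + 3 * Suc j) = vc m j" "VS m (3 + 3 * Suc j + 3 * k) = va m (j + k)"
    "VS m (4 + 3 * Suc j + 3 * k) = vb m (j + k)" "VS m (5 + 3 * Suc j + 3 * k) = vc m (j + k)"
    "VS m (5 + 3 * Suc j + 1) = va m (Suc j)" "VS m (5 + 3 * Suc j + 1 + 3 * k) = va m (Suc (j + k))"
    "VS m (5 + 3 * Suc j + 3 * k + 1) = va m (Suc (j + k))" for j
    by (simp_all add: va_def vb_def vc_def)
  show ?thesis
    unfolding subset_edges_def Let_def I v U w
    by (simp add: less_diff_conv w Bex_def ex_disj_distrib conj_disj_distribL disj_ac)
qed

section \<open>Possible neighbours of the individual vertices\<close>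

context simple_instance
begin

text \<open>Phrased in simplified form, to discharge the side condition of
  \<open>subset_edges_iff\<close> automatically.\<close>

lemma card_pos: "Suc 0 \<le> m \<Longrightarrow> m \<le> s \<Longrightarrow> Suc 0 \<le> card (S m)"
  using card_ge_2[of m] by simp

lemma edge_from_va:
  assumes "(va m j, y) \<in> E"
  shows "y = vb m j \<or> (\<exists>i\<in>{1..u}. (va m j, y) \<in> membership_edges s S i)"
  using assms unfolding edges_iff
  by (auto simp: element_edges_def linking_edges_def subset_edges_iff card_pos)

lemma edge_to_vc:
  assumes "(x, vc m j) \<in> E"
  shows "x = vb m j \<or> (\<exists>i\<in>{1..u}. (x, vc m j) \<in> membership_edges s S i)"
  using assms unfolding edges_iff
  by (auto simp: element_edges_def linking_edges_def subset_edges_iff card_pos)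

lemma edge_vb:
  shows "(vb m j, y) \<in> E \<Longrightarrow> y = va m j \<or> y = vc m j"
    and "(x, vb m j) \<in> E \<Longrightarrow> x = va m j \<or> x = vc m j"
  unfolding edges_iff
  by (auto simp: element_edges_def linking_edges_def subset_edges_iff card_pos membership_edges_iff)

lemma edge_bridge_middle:
  shows "(VS m 4, y) \<in> E \<Longrightarrow> y = VS m 3 \<or> y = VS m 5"
    and "(x, VS m 4) \<in> E \<Longrightarrow> x = VS m 3 \<or> x = VS m 5"
  unfolding edges_iff
  by (auto simp: element_edges_def linking_edges_def subset_edges_iff card_pos membership_edges_iff)

lemma edge_bridge_upper:
  shows "(VS m 3, y) \<in> E \<Longrightarrow> y = VS m 4 \<or> (\<exists>j<card (S m). y = va m j)"
    and "(x, VS m 3) \<in> E \<Longrightarrow> x = VS m 4 \<or> (\<exists>j<card (S m). x = vc m j)"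
  unfolding edges_iff
  by (auto simp: element_edges_def linking_edges_def subset_edges_iff card_pos membership_edges_iff)

lemma edge_bridge_lower:
  shows "(VS m 5, y) \<in> E \<Longrightarrow> y = VS m 4 \<or> (\<exists>j<card (S m). y = va m (j + card (S m)))"
    and "(x, VS m 5) \<in> E \<Longrightarrow> x = VS m 4 \<or> (\<exists>j<card (S m). x = vc m (j + card (S m)))"
  unfolding edges_iff
  by (auto simp: element_edges_def linking_edges_def subset_edges_iff card_pos membership_edges_iff)

lemma edge_from_VU1: "(VU i 1, y) \<in> E \<Longrightarrow> \<exists>r. y = port r i"
  unfolding edges_iff port_def
  by (auto simp: element_edges_def linking_edges_def subset_edges_iff card_pos membership_edges_iff
      port_def ex_bool_eq split: if_splits)

lemma edge_to_port: "(x, port r i) \<in> E \<Longrightarrow> x = VU i 1 \<or> x = port (\<not> r) i"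
  unfolding edges_iff port_def
  by (auto simp: element_edges_def linking_edges_def subset_edges_iff card_pos membership_edges_iff
      split: if_splits)

lemma edge_from_port:
  "(port r i, y) \<in> E \<Longrightarrow> y = port (\<not> r) i \<or> y = vc (occ i ! 0) (slot S r (occ i ! 0) i)"
  unfolding edges_iff port_def
  by (auto simp: element_edges_def linking_edges_def subset_edges_iff card_pos membership_edges_iff
      port_def split: if_splits)

text \<open>Within a set the slot determines row and element; the place in the chain follows because
  \<open>occ i\<close> lists each set once.\<close>

lemma occ_slot_inject:
  assumes "q < length (occ i)" "q' < length (occ i')" "occ i ! q = occ i' ! q'"
    "slot S r (occ i ! q) i = slot S r' (occ i' ! q') i'"
  shows "q = q' \<and> r = r' \<and> i = i'"
proof -
  have "r = r' \<and> i = i'"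
    using slot_inject[of "occ i ! q" i i' r r'] nth_occ[OF assms(1)] nth_occ[OF assms(2)] assms(3,4)
    by simp
  then show ?thesis
    using assms distinct_occ[of i] by (simp add: nth_eq_iff_index_eq)
qed

text \<open>By \<open>occ_slot_inject\<close> no other chain touches this triple. Apart from the
  middle vertex, only the preceding place of its own chain leads to \<open>vc\<close>; for
  \<open>q = 0\<close> this is the port.\<close>

lemma edge_into_chain:
  assumes "i \<in> {1..u}" "q < length (occ i)" "(x, vc (occ i ! q) (slot S r (occ i ! q) i)) \<in> E"
  shows "x = vb (occ i ! q) (slot S r (occ i ! q) i) \<or>
    x = (if q = 0 then port r i else va (occ i ! (q - 1)) (slot S r (occ i ! (q - 1)) i))"
proof -
  note * = occ_slot_inject[OF assms(2)]
  have ne: "0 < length (occ i')" if "i' \<in> {1..u}" for i'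
    using occ_nonempty[OF that] by simp
  from edge_to_vc[OF assms(3)] show ?thesis
  proof
    assume "\<exists>i'\<in>{1..u}. (x, vc (occ i ! q) (slot S r (occ i ! q) i)) \<in> membership_edges s S i'"
    then obtain i' where i': "i' \<in> {1..u}"
      and "(x, vc (occ i ! q) (slot S r (occ i ! q) i)) \<in> membership_edges s S i'" by blast
    then consider r' where "x = port r' i'" "occ i ! q = occ i' ! 0"
        "slot S r (occ i ! q) i = slot S r' (occ i' ! 0) i'"
      | r' q' where "Suc q' < length (occ i')" "x = va (occ i' ! q') (slot S r' (occ i' ! q') i')"
        "occ i ! q = occ i' ! Suc q'" "slot S r (occ i ! q) i = slot S r' (occ i' ! Suc q') i'"
      unfolding membership_edges_iff[OF i'] by auto
    then show ?thesis
    proof cases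
      case 1
      with *[OF ne[OF i'], of r r'] show ?thesis by simp
    next
      case 2
      with *[of "Suc q'" i' r r'] show ?thesis by simp
    qed
  qed simp
qed

text \<open>Counterpart of \<open>edge_into_chain\<close>. The bound on \<open>Suc q\<close>
  excludes the last triple, whose \<open>va\<close> leads on to \<open>VU i 4\<close>.\<close>

lemma edge_out_of_chain:
  assumes "i \<in> {1..u}" "Suc q < length (occ i)" "(va (occ i ! q) (slot S r (occ i ! q) i), y) \<in> E"
  shows "y = vb (occ i ! q) (slot S r (occ i ! q) i) \<or>
    y = vc (occ i ! Suc q) (slot S r (occ i ! Suc q) i)"
proof -
  have q: "q < length (occ i)" using assms(2) by simp
  note * = occ_slot_inject[OF q]
  from edge_from_va[OF assms(3)] show ?thesis
  proof
    assume "\<exists>i'\<in>{1..u}. (va (occ i ! q) (slot S r (occ i ! q) i), y) \<in> membership_edges s S i'"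
    then obtain i' where i': "i' \<in> {1..u}"
      and "(va (occ i ! q) (slot S r (occ i ! q) i), y) \<in> membership_edges s S i'" by blast
    note ne = occ_nonempty[OF i']
    have l: "last (occ i') = occ i' ! (length (occ i') - 1)" using ne by (rule last_conv_nth)
    consider r' where "occ i ! q = occ i' ! (length (occ i') - 1)"
        "slot S r (occ i ! q) i = slot S r' (occ i' ! (length (occ i') - 1)) i'"
      | r' q' where "Suc q' < length (occ i')" "y = vc (occ i' ! Suc q') (slot S r' (occ i' ! Suc q') i')"
        "occ i ! q = occ i' ! q'" "slot S r (occ i ! q) i = slot S r' (occ i' ! q') i'"
      using \<open>(_, y) \<in> membership_edges s S i'\<close>
      unfolding membership_edges_iff[OF i'] l by auto
    then show ?thesis
    proof cases
      case 1
      with *[of "length (occ i') - 1" i' r r'] ne assms(2) show ?thesis by simp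
    next
      case 2
      with *[of q' i' r r'] show ?thesis by simp
    qed
  qed simp
qed

section \<open>The vertex set, and arcs within it\<close>

lemma finite_vertices: "finite (vertices u s S)"
  by (auto simp: vertices_def)

lemma vertices_simps [simp]:
  "VU i l \<in> vertices u s S \<longleftrightarrow> i \<in> {1..u} \<and> l \<in> {1..4}"
  "VS m l \<in> vertices u s S \<longleftrightarrow> m \<in> {1..s} \<and> l \<in> {1..5 + 6 * card (S m)}"
  "VC l \<in> vertices u s S \<longleftrightarrow> l \<in> {1, 2}"
  by (fastforce simp: vertices_def)+

lemma abc_vertices [simp]:
  assumes "m \<in> {1..s}"
  shows "va m j \<in> vertices u s S \<longleftrightarrow> j < 2 * card (S m)"
    "vb m j \<in> vertices u s S \<longleftrightarrow> j < 2 * card (S m)"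
    "vc m j \<in> vertices u s S \<longleftrightarrow> j < 2 * card (S m)"
  using assms by (auto simp: va_def vb_def vc_def)

lemma port_vertices [simp]: "port r i \<in> vertices u s S \<longleftrightarrow> i \<in> {1..u}"
  by (simp add: port_def)

lemma edges_subset: "E \<subseteq> vertices u s S \<times> vertices u s S"
proof (rule subrelI)
  fix x y assume "(x, y) \<in> E"
  \<comment> \<open>The linking arcs at \<open>VS 1 1\<close> and \<open>VS s 2\<close> presuppose
    that there is a set.\<close>
  moreover have "1 \<le> s"
    using covered[of 1] universe_nonempty by auto
  moreover have "(x, y) \<in> vertices u s S \<times> vertices u s S"
    if i: "i \<in> {1..u}" "(x, y) \<in> membership_edges s S i" for i
  proof -
    have *: "occ i ! q \<in> {1..s} \<and> slot S r (occ i ! q) i < 2 * card (S (occ i ! q))"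
      if "q < length (occ i)" for q r
      using nth_occ[OF that] slot_less by blast
    have "last (occ i) = occ i ! (length (occ i) - 1)" "0 < length (occ i)"
      using occ_nonempty[OF i(1)] by (simp_all add: last_conv_nth)
    then show ?thesis
      using i(2) * i(1) unfolding membership_edges_iff[OF i(1)]
      by (auto simp del: atLeastAtMost_iff) auto
  qed
  moreover have "(x, y) \<in> vertices u s S \<times> vertices u s S"
    if m: "m \<in> {1..s}" "(x, y) \<in> subset_edges m (card (S m))" for m
    using card_ge_2[OF m(1)] m
    by (auto simp: subset_edges_iff)
  ultimately show "(x, y) \<in> vertices u s S \<times> vertices u s S"
    unfolding edges_iff
    using universe_nonempty by (auto simp: element_edges_def linking_edges_def)
qed

end


section \<open>From cycles to solutions\<close>

text \<open>Only the arc set of a cycle is kept here; the order of visits comes back in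
  \<open>corresponding_pair_conv\<close>.\<close>

locale cycle_arcs = simple_instance +
  fixes H :: "vertex rel"
  assumes arcs_subset: "H \<subseteq> E"
    and out_exists: "x \<in> vertices u s S \<Longrightarrow> \<exists>y. (x, y) \<in> H"
    and in_exists: "y \<in> vertices u s S \<Longrightarrow> \<exists>x. (x, y) \<in> H"
    and out_unique: "(x, y) \<in> H \<Longrightarrow> (x, y') \<in> H \<Longrightarrow> y = y'"
    and in_unique: "(x, y) \<in> H \<Longrightarrow> (x', y) \<in> H \<Longrightarrow> x = x'"
    and no_two_cycle: "(x, y) \<in> H \<Longrightarrow> (y, x) \<notin> H"
begin

text \<open>The predecessor and the successor of \<open>b\<close> are both among \<open>a\<close>
  and \<open>c\<close>, and they differ because there is no 2-cycle.\<close>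

lemma middle_vertex:
  assumes "b \<in> vertices u s S"
    and "\<And>y. (b, y) \<in> E \<Longrightarrow> y = a \<or> y = c" "\<And>x. (x, b) \<in> E \<Longrightarrow> x = a \<or> x = c"
  shows "(a, b) \<in> H \<and> (b, c) \<in> H \<or> (c, b) \<in> H \<and> (b, a) \<in> H"
  using assms out_exists[of b] in_exists[of b] no_two_cycle arcs_subset by blast

text \<open>A triple is forward if the cycle runs through it in the direction of the gadget, and not as
  part of the chain of its element.\<close>

definition forward :: "nat \<Rightarrow> nat \<Rightarrow> bool" where
  "forward m j \<longleftrightarrow> (va m j, vb m j) \<in> H"

lemma triple:
  assumes "m \<in> {1..s}" "j < 2 * card (S m)"
  shows "forward m j \<Longrightarrow> (vb m j, vc m j) \<in> H"
    and "\<not> forward m j \<Longrightarrow> (vc m j, vb m j) \<in> H \<and> (vb m j, va m j) \<in> H"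
proof -
  have "(va m j, vb m j) \<in> H \<and> (vb m j, vc m j) \<in> H \<or> (vc m j, vb m j) \<in> H \<and> (vb m j, va m j) \<in> H"
    using assms by (intro middle_vertex) (auto dest: edge_vb)
  then show "forward m j \<Longrightarrow> (vb m j, vc m j) \<in> H"
    and "\<not> forward m j \<Longrightarrow> (vc m j, vb m j) \<in> H \<and> (vb m j, va m j) \<in> H"
    unfolding forward_def using no_two_cycle by blast+
qed

lemma forward_iff:
  assumes "m \<in> {1..s}" "j < 2 * card (S m)"
  shows "forward m j \<longleftrightarrow> (vb m j, vc m j) \<in> H"
  using triple[OF assms] no_two_cycle by blast

text \<open>Induction along the chain. The entry \<open>vc\<close> of a triple is reached either
  from its \<open>vb\<close>, when the triple is forward, or by the chain arc. The tail of that arc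
  either uses it or takes its only alternative: the other port at the start, \<open>vb\<close> of
  the previous triple later on. Uniqueness of successors and predecessors makes both choices
  agree.\<close>

lemma forward_conv_port_nth:
  assumes i: "i \<in> {1..u}" and "q < length (occ i)"
  shows "forward (occ i ! q) (slot S r (occ i ! q) i) \<longleftrightarrow> (port r i, port (\<not> r) i) \<in> H"
  using assms(2)
proof (induction q)
  case 0
  let ?m = "occ i ! 0" and ?j = "slot S r (occ i ! 0) i"
  have m: "?m \<in> {1..s}" "?j < 2 * card (S ?m)"
    using nth_occ[OF 0] slot_less by auto
  obtain x where x: "(x, vc ?m ?j) \<in> H" using in_exists[of "vc ?m ?j"] m by auto
  then have x': "x = vb ?m ?j \<or> x = port r i"
    using edge_into_chain[OF i 0] arcs_subset by auto
  obtain y where y: "(port r i, y) \<in> H" using out_exists[of "port r i"] i by auto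
  then have "y = port (\<not> r) i \<or> y = vc ?m ?j"
    using edge_from_port arcs_subset by blast
  with x x' y show ?case
    unfolding forward_iff[OF m] using in_unique out_unique abc_port_distinct by metis
next
  case (Suc q)
  let ?m = "occ i ! q" and ?j = "slot S r (occ i ! q) i"
  let ?m' = "occ i ! Suc q" and ?j' = "slot S r (occ i ! Suc q) i"
  have q: "q < length (occ i)" using Suc.prems by simp
  have m: "?m \<in> {1..s}" "?j < 2 * card (S ?m)"
    using nth_occ[OF q] slot_less by auto
  have m': "?m' \<in> {1..s}" "?j' < 2 * card (S ?m')"
    using nth_occ[OF Suc.prems] slot_less by auto
  obtain x where x: "(x, vc ?m' ?j') \<in> H" using in_exists[of "vc ?m' ?j'"] m' by auto
  then have x': "x = vb ?m' ?j' \<or> x = va ?m ?j"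
    using edge_into_chain[OF i Suc.prems] arcs_subset by auto
  obtain y where y: "(va ?m ?j, y) \<in> H" using out_exists[of "va ?m ?j"] m by auto
  then have "y = vb ?m ?j \<or> y = vc ?m' ?j'"
    using edge_out_of_chain[OF i Suc.prems] arcs_subset by blast
  with x x' y have "forward ?m' ?j' \<longleftrightarrow> forward ?m ?j"
    unfolding forward_iff[OF m'] forward_def[of ?m] using in_unique out_unique abc_distinct by metis
  then show ?case using Suc.IH[OF q] by simp
qed

lemma forward_conv_port:
  assumes "m \<in> {1..s}" "i \<in> S m"
  shows "forward m (slot S r m i) \<longleftrightarrow> (port r i, port (\<not> r) i) \<in> H"
proof -
  obtain q where "q < length (occ i)" "occ i ! q = m"
    using set_occ[of i] assms by (metis (mono_tags, lifting) in_set_conv_nth mem_Collect_eq)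
  then show ?thesis
    using forward_conv_port_nth[of i q r] subset_universe assms by blast
qed

text \<open>\<open>VU i 1\<close> has a single successor, so the port it does not lead to can only
  be entered from the other port.\<close>

lemma port_arc_exists:
  assumes "i \<in> {1..u}"
  shows "\<exists>r. (port r i, port (\<not> r) i) \<in> H"
proof -
  have "VU i 1 \<in> vertices u s S" using assms by simp
  then obtain r where r: "(VU i 1, port r i) \<in> H"
    using out_exists edge_from_VU1 arcs_subset by blast
  obtain x where x: "(x, port (\<not> r) i) \<in> H"
    using in_exists[of "port (\<not> r) i"] assms by auto
  then have "x = VU i 1 \<or> x = port r i"
    using edge_to_port[of x "\<not> r" i] arcs_subset by auto
  moreover have "x \<noteq> VU i 1"
    using x r out_unique by fastforce
  ultimately show ?thesis using x by blast
qed

text \<open>\<open>VS m 3\<close>, \<open>VS m 4\<close> and \<open>VS m 5\<close> are passed in one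
  go. One end is entered from a triple of its row and the other end is left for a triple of the
  other row. Both triples are forward, which \<open>forward_conv_port\<close> turns into arcs
  between the ports of their elements.\<close>

lemma set_is_split:
  assumes m: "m \<in> {1..s}"
  obtains i i' where "i \<in> S m" "i' \<in> S m"
    "(port False i, port True i) \<in> H" "(port True i', port False i') \<in> H"
proof -
  let ?k = "card (S m)"
  have V: "VS m 3 \<in> vertices u s S" "VS m 4 \<in> vertices u s S" "VS m 5 \<in> vertices u s S"
    using m by auto
  \<comment> \<open>In a backward triple \<open>va\<close> is entered from \<open>vb\<close> and
    \<open>vc\<close> is left towards \<open>vb\<close>, so any other arc of the cycle at these
    places shows the triple to be forward.\<close>
  have in_fwd: "forward m j" if "(x, va m j) \<in> H" "x \<noteq> vb m j" "j < 2 * ?k" for x j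
    using triple(2)[OF m that(3)] that in_unique by blast
  have out_fwd: "forward m j" if "(vc m j, y) \<in> H" "y \<noteq> vb m j" "j < 2 * ?k" for y j
    using triple(2)[OF m that(3)] that out_unique by blast
  obtain x3 where x3: "(x3, VS m 3) \<in> H" using in_exists V by blast
  obtain y3 where y3: "(VS m 3, y3) \<in> H" using out_exists V by blast
  obtain x5 where x5: "(x5, VS m 5) \<in> H" using in_exists V by blast
  obtain y5 where y5: "(VS m 5, y5) \<in> H" using out_exists V by blast
  have "(VS m 3, VS m 4) \<in> H \<and> (VS m 4, VS m 5) \<in> H \<or> (VS m 5, VS m 4) \<in> H \<and> (VS m 4, VS m 3) \<in> H"
    by (rule middle_vertex[OF V(2)]) (use edge_bridge_middle in blast)+
  then have "\<exists>j<?k. \<exists>j'<?k. forward m j \<and> forward m (j' + ?k)"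
  proof (elim disjE conjE)
    assume "(VS m 3, VS m 4) \<in> H" "(VS m 4, VS m 5) \<in> H"
    then have "x3 \<noteq> VS m 4" "y5 \<noteq> VS m 4" using x3 y5 no_two_cycle by blast+
    then obtain j j' where "j < ?k" "x3 = vc m j" "j' < ?k" "y5 = va m (j' + ?k)"
      using edge_bridge_upper(2) edge_bridge_lower(1) x3 y5 arcs_subset by blast
    then show ?thesis
      using in_fwd[of "VS m 5" "j' + ?k"] out_fwd[of j "VS m 3"] x3 y5 by auto
  next
    assume "(VS m 5, VS m 4) \<in> H" "(VS m 4, VS m 3) \<in> H"
    then have "x5 \<noteq> VS m 4" "y3 \<noteq> VS m 4" using x5 y3 no_two_cycle by blast+
    then obtain j j' where "j < ?k" "y3 = va m j" "j' < ?k" "x5 = vc m (j' + ?k)"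
      using edge_bridge_upper(1) edge_bridge_lower(2) x5 y3 arcs_subset by blast
    then show ?thesis
      using in_fwd[of "VS m 3" j] out_fwd[of "j' + ?k" "VS m 5"] x5 y3 by auto
  qed
  then obtain j j' where j: "j < ?k" "j' < ?k" "forward m j" "forward m (j' + ?k)" by blast
  obtain i where i: "i \<in> S m" "slot S False m i = j"
    using slot_surj[OF m j(1)] by (metis add_0)
  obtain i' where i': "i' \<in> S m" "slot S True m i' = j' + ?k"
    using slot_surj[OF m j(2)] by (metis add.commute)
  show ?thesis
    using that[of i i'] forward_conv_port[OF m i(1), of False] forward_conv_port[OF m i'(1), of True]
      i i' j by simp
qed

end

section \<open>The corresponding pair read off from the arcs\<close>

context simple_instance
begin

abbreviation "\<Gamma> \<equiv> ssp_graph u s S"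

lemma pverts_ssp_graph [simp]: "pverts \<Gamma> = vertices u s S"
  and parcs_ssp_graph [simp]: "parcs \<Gamma> = E"
  by (simp_all add: ssp_graph_def)

lemma cycleD:
  assumes "hamiltonian_cycle \<Gamma> p"
  shows "set p \<subseteq> E" "distinct (map fst p)" "set (map fst p) = vertices u s S"
    "map snd p = rotate1 (map fst p)"
  using hamiltonian_cycleD[OF assms] finite_vertices edges_subset by simp_all

lemma cycle_arcs_of_cycle:
  assumes "hamiltonian_cycle \<Gamma> p"
  shows "cycle_arcs u s S (set p)"
proof -
  note p = cycleD[OF assms]
  have snd: "set (map snd p) = vertices u s S" "distinct (map snd p)"
    unfolding p(4) using p by auto
  have zip: "p = zip (map fst p) (rotate1 (map fst p))"
    using p(4) by (metis zip_map_fst_snd)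
  \<comment> \<open>Three vertices in the gadget of element 1 give the length that
    \<open>rotate1_no_two_cycle\<close> asks for.\<close>
  have "{VU 1 1, VU 1 2, VU 1 3} \<subseteq> vertices u s S" using universe_nonempty by auto
  then have "card {VU 1 1, VU 1 2, VU 1 3} \<le> card (vertices u s S)"
    by (rule card_mono[OF finite_vertices])
  also have "card (vertices u s S) = length p"
    using p(2,3) by (metis distinct_card length_map)
  finally have len: "3 \<le> length (map fst p)" by simp
  show ?thesis
  proof
    show "set p \<subseteq> E" by fact
    show "\<exists>y. (x, y) \<in> set p" if "x \<in> vertices u s S" for x
      using that p(3) by force
    show "\<exists>x. (x, y) \<in> set p" if "y \<in> vertices u s S" for y
      using that snd(1) by force
    show "y = y'" if "(x, y) \<in> set p" "(x, y') \<in> set p" for x y y'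
      using eq_key_imp_eq_value[OF p(2) that] .
    show "x = x'" if "(x, y) \<in> set p" "(x', y) \<in> set p" for x x' y
      using snd(2) that by (metis distinct_map inj_onD prod.inject snd_conv)
    show "(y, x) \<notin> set p" if "(x, y) \<in> set p" for x y
      using rotate1_no_two_cycle[OF p(2) len] that zip by metis
  qed
qed

text \<open>The two ports of an element are joined by an arc of the cycle in one of the directions.
  They are therefore consecutive in the traversal, and the direction of the arc is the order of the
  visits.\<close>

lemma corresponding_pair_conv:
  assumes "hamiltonian_cycle \<Gamma> p"
  shows "corresponding_pair u p =
    ({i\<in>{1..u}. (port False i, port True i) \<in> set p}, {i\<in>{1..u}. (port True i, port False i) \<in> set p})"
proof -
  note p = cycleD[OF assms]
  interpret cycle_arcs u s S "set p" by (rule cycle_arcs_of_cycle) fact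
  have v: "visited_after (traversal p) (port (\<not> r) i) (port r i) \<longleftrightarrow> (port r i, port (\<not> r) i) \<in> set p"
    if i: "i \<in> {1..u}" for i r
  proof -
    have *: "visited_after (traversal p) (port (\<not> r) i) (port r i)"
      if "(port r i, port (\<not> r) i) \<in> set p" for r
      using visited_after_arc[OF that _ _ p(4)] p(3) universe_nonempty by (auto simp: port_def)
    show ?thesis
    proof (cases "(port r i, port (\<not> r) i) \<in> set p")
      case False
      moreover obtain r' where "(port r' i, port (\<not> r') i) \<in> set p" using port_arc_exists[OF i] ..
      ultimately have "r' = (\<not> r)" by (cases r; cases r') auto
      then have "visited_after (traversal p) (port r i) (port (\<not> r) i)"
        using *[of r'] \<open>(port r' i, _) \<in> set p\<close> by simp
      then show ?thesis
        using False visited_after_asym[OF distinct_traversal[OF p(2)]] by blast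
    qed (use *[of r] in blast)
  qed
  have "VU i 2 = port True i" "VU i 3 = port False i" for i by (simp_all add: port_def)
  then show ?thesis
    using v[of _ True] v[of _ False] unfolding corresponding_pair_def by auto
qed

lemma corresponding_pair_solution:
  assumes "hamiltonian_cycle \<Gamma> p"
  shows "ssp_solution {1..u} (S ` {1..s}) (corresponding_pair u p)"
proof -
  interpret cycle_arcs u s S "set p" by (rule cycle_arcs_of_cycle) fact
  let ?P = "corresponding_pair u p"
  note P = corresponding_pair_conv[OF assms]
  have "(port True i, port False i) \<in> set p \<or> (port False i, port True i) \<in> set p"
    if "i \<in> {1..u}" for i
    using port_arc_exists[OF that] by (simp add: ex_bool_eq)
  then have "fst ?P \<union> snd ?P = {1..u}"
    unfolding P fst_conv snd_conv by blast
  moreover have disj: "fst ?P \<inter> snd ?P = {}"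
    unfolding P using no_two_cycle by auto
  moreover have split: "\<exists>i\<in>S m. \<exists>i'\<in>S m. i \<in> fst ?P \<and> i' \<in> snd ?P" if "m \<in> {1..s}" for m
    using set_is_split[OF that] subset_universe[OF that] unfolding P by (smt (verit) fst_conv mem_Collect_eq snd_conv subsetD)
  \<comment> \<open>A split set meets both parts, so the existence of one set makes both parts
    non-empty.\<close>
  moreover have "\<exists>m. m \<in> {1..s}"
    using covered[of 1] universe_nonempty by auto
  moreover have "splits ?P (S m)" if "m \<in> {1..s}" for m
    using split[OF that] disj unfolding splits_def by blast
  ultimately show ?thesis
    unfolding ssp_solution_def two_partition_def by blast
qed

end


section \<open>From solutions to cycles\<close>

text \<open>Vertices may repeat; distinctness of the tour is obtained afterwards by
  counting.\<close>

definition walk :: "'a rel \<Rightarrow> 'a \<Rightarrow> 'a list \<Rightarrow> 'a \<Rightarrow> bool" where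
  "walk R x xs y \<longleftrightarrow> xs \<noteq> [] \<and> hd xs = x \<and> last xs = y \<and> successively (\<lambda>a b. (a, b) \<in> R) xs"

lemma walk_singleton: "walk R x [x] x"
  by (simp add: walk_def)

lemma walk_append:
  "walk R x xs y \<Longrightarrow> (y, y') \<in> R \<Longrightarrow> walk R y' ys z \<Longrightarrow> walk R x (xs @ ys) z"
  by (auto simp: walk_def successively_append_iff)

lemma walk_Cons: "(x, y) \<in> R \<Longrightarrow> walk R y ys z \<Longrightarrow> walk R x (x # ys) z"
  by (cases ys) (auto simp: walk_def)

lemma walk_simps:
  "walk R x [v] z \<longleftrightarrow> x = v \<and> z = v"
  "walk R x (v # w # vs) z \<longleftrightarrow> x = v \<and> (v, w) \<in> R \<and> walk R w (w # vs) z"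
  by (auto simp: walk_def)

text \<open>With \<open>Suc n\<close> pieces there always are a first and a last piece to supply the
  end points.\<close>

lemma walk_concat:
  assumes "\<And>j. j < Suc n \<Longrightarrow> walk R (a j) (f j) (b j)"
    and "\<And>j. Suc j < Suc n \<Longrightarrow> (b j, a (Suc j)) \<in> R"
  shows "walk R (a 0) (concat (map f [0..<Suc n])) (b n)"
  using assms
proof (induction n)
  case (Suc n)
  then have "walk R (a 0) (concat (map f [0..<Suc n])) (b n)" by auto
  then have "walk R (a 0) (concat (map f [0..<Suc n]) @ f (Suc n)) (b (Suc n))"
    using Suc.prems by (intro walk_append[where y = "b n" and y' = "a (Suc n)"]) auto
  then show ?case by simp
qed simp

lemma walk_concat_from_1:
  assumes "1 \<le> n" "\<And>j. j \<in> {1..n} \<Longrightarrow> walk R (a j) (f j) (b j)"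
    and "\<And>j. j \<in> {1..<n} \<Longrightarrow> (b j, a (j + 1)) \<in> R"
  shows "walk R (a 1) (concat (map f [1..<Suc n])) (b n)"
proof -
  obtain n' where n: "n = Suc n'" using assms(1) by (cases n) auto
  have "walk R (a (Suc 0)) (concat (map (\<lambda>j. f (Suc j)) [0..<Suc n'])) (b (Suc n'))"
    by (rule walk_concat[where a = "\<lambda>j. a (Suc j)" and b = "\<lambda>j. b (Suc j)"])
      (use assms(2,3)[of "Suc _"] n in simp_all)
  moreover have "map (\<lambda>j. f (Suc j)) [0..<Suc n'] = map f [1..<Suc n]"
    unfolding n by (simp only: One_nat_def map_Suc_upt[symmetric] map_map comp_def)
  ultimately show ?thesis using n by simp
qed

lemma closed_walk_arcs:
  assumes "walk R x xs y" "(y, x) \<in> R"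
  shows "set (zip xs (rotate1 xs)) \<subseteq> R"
proof (rule subrelI)
  fix v w assume "(v, w) \<in> set (zip xs (rotate1 xs))"
  then obtain j where j: "j < length xs" "v = xs ! j" "w = xs ! (Suc j mod length xs)"
    by (auto simp: in_set_zip nth_rotate1)
  show "(v, w) \<in> R"
  proof (cases "Suc j = length xs")
    \<comment> \<open>The last position wraps around and contributes the closing arc from
      \<open>y\<close> to \<open>x\<close>.\<close>
    case True
    have "xs \<noteq> []" using assms(1) by (simp add: walk_def)
    then have "last xs = v" "hd xs = w"
      using j unfolding True[symmetric]
      by (simp_all add: last_conv_nth hd_conv_nth True[symmetric])
    then show ?thesis using assms by (simp add: walk_def)
  next
    case False
    then have "Suc j < length xs" using j by simp
    then show ?thesis
      using j assms(1) by (simp add: walk_def successively_conv_nth)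
  qed
qed

lemma consecutive_in_zip_rotate1:
  "(x, y) \<in> set (zip (us @ x # y # vs) (rotate1 (us @ x # y # vs)))"
  unfolding in_set_zip
  by (rule exI[of _ "length us"]) (simp add: nth_rotate1 nth_append)

section \<open>Arcs available to the tour, and the number of vertices\<close>

context simple_instance
begin

lemma element_arcs:
  assumes "i \<in> {1..u}"
  shows "(VU i 1, port r i) \<in> E" "(port r i, port (\<not> r) i) \<in> E"
    "(port r i, vc (occ i ! 0) (slot S r (occ i ! 0) i)) \<in> E"
    "(va (last (occ i)) (slot S r (last (occ i)) i), VU i 4) \<in> E"
    "Suc q < length (occ i) \<Longrightarrow> (va (occ i ! q) (slot S r (occ i ! q) i),
       vc (occ i ! Suc q) (slot S r (occ i ! Suc q) i)) \<in> E"
proof -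
  have "(VU i 1, port r i) \<in> element_edges i" "(port r i, port (\<not> r) i) \<in> element_edges i"
    by (auto simp: element_edges_def port_def)
  then show "(VU i 1, port r i) \<in> E" "(port r i, port (\<not> r) i) \<in> E"
    using assms unfolding edges_iff by blast+
  have M: "membership_edges s S i \<subseteq> E" using assms by (auto simp: edges_def)
  show "(port r i, vc (occ i ! 0) (slot S r (occ i ! 0) i)) \<in> E"
    "(va (last (occ i)) (slot S r (last (occ i)) i), VU i 4) \<in> E"
    "Suc q < length (occ i) \<Longrightarrow> (va (occ i ! q) (slot S r (occ i ! q) i),
       vc (occ i ! Suc q) (slot S r (occ i ! Suc q) i)) \<in> E"
    by (rule subsetD[OF M]; use membership_edges_iff[OF assms] in blast)+
qed

text \<open>Stated for a triple of either row: \<open>t\<close> and \<open>t'\<close> choose rows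
  independently, because neighbouring columns are joined in all four ways.\<close>

lemma set_arcs:
  assumes "m \<in> {1..s}"
  defines "k \<equiv> card (S m)"
  shows "t \<in> {0, k} \<Longrightarrow> (VS m 1, va m t) \<in> E"
    and "t \<in> {k - 1, k - 1 + k} \<Longrightarrow> (vc m t, VS m 2) \<in> E"
    and "t < 2 * k \<Longrightarrow> {(va m t, vb m t), (vb m t, vc m t), (vc m t, vb m t), (vb m t, va m t)} \<subseteq> E"
    and "Suc j < k \<Longrightarrow> t \<in> {j, j + k} \<Longrightarrow> t' \<in> {Suc j, Suc j + k} \<Longrightarrow> (vc m t, va m t') \<in> E"
    and "Suc j < k \<Longrightarrow> {(vc m j, VS m 3), (VS m 3, va m (Suc j)), (vc m (j + k), VS m 5),
         (VS m 5, va m (Suc j + k))} \<subseteq> E"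
    and "{(VS m 3, VS m 4), (VS m 4, VS m 3), (VS m 4, VS m 5), (VS m 5, VS m 4)} \<subseteq> E"
proof -
  have M: "subset_edges m k \<subseteq> E" using assms by (auto simp: edges_def)
  have k: "1 \<le> k" using card_ge_2[OF assms(1)] by (simp add: k_def)
  note I = subset_edges_iff[OF k, of _ _ m]
  show "(VS m 1, va m t) \<in> E" if "t \<in> {0, k}"
    using that by (intro subsetD[OF M]) (auto simp: I)
  have "k - 1 + k = 2 * k - 1" using k by simp
  then show "(vc m t, VS m 2) \<in> E" if "t \<in> {k - 1, k - 1 + k}"
    using that by (intro subsetD[OF M]) (auto simp: I)
  show "{(va m t, vb m t), (vb m t, vc m t), (vc m t, vb m t), (vb m t, va m t)} \<subseteq> E" if "t < 2 * k"
  proof -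
    obtain j where "j < k" "t = j \<or> t = j + k"
    proof (cases "t < k")
      case False
      then show thesis using that \<open>t < 2 * k\<close> by (intro that[of "t - k"]) auto
    qed (use that in blast)
    then show ?thesis by (intro subset_trans[OF _ M]) (auto simp: I)
  qed
  show "(vc m t, va m t') \<in> E"
    if "Suc j < k" "t \<in> {j, j + k}" "t' \<in> {Suc j, Suc j + k}"
    using that by (intro subsetD[OF M]) (auto simp: I)
  show "{(vc m j, VS m 3), (VS m 3, va m (Suc j)), (vc m (j + k), VS m 5),
         (VS m 5, va m (Suc j + k))} \<subseteq> E" if "Suc j < k"
    using that by (intro subset_trans[OF _ M]) (auto simp: I)
  show "{(VS m 3, VS m 4), (VS m 4, VS m 3), (VS m 4, VS m 5), (VS m 5, VS m 4)} \<subseteq> E"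
    by (intro subset_trans[OF _ M]) (auto simp: I)
qed

lemma linking_arcs:
  "(VU u 4, VC 1) \<in> E" "(VC 1, VS 1 1) \<in> E" "(VS s 2, VC 2) \<in> E" "(VC 2, VU 1 1) \<in> E"
  "i \<in> {1..<u} \<Longrightarrow> (VU i 4, VU (i + 1) 1) \<in> E" "m \<in> {1..<s} \<Longrightarrow> (VS m 2, VS (m + 1) 1) \<in> E"
  by (auto simp: edges_def linking_edges_def)

lemma card_vertices: "card (vertices u s S) = 4 * u + (\<Sum>m\<in>{1..s}. 5 + 6 * card (S m)) + 2"
proof -
  let ?A = "\<Union>i\<in>{1..u}. VU i ` {1..4::nat}"
  let ?B = "\<Union>m\<in>{1..s}. VS m ` {1..5 + 6 * card (S m)}"
  have "card ?A = (\<Sum>i\<in>{1..u}. card (VU i ` {1..4::nat}))"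
    by (rule card_UN_disjoint) auto
  also have "\<dots> = (\<Sum>i\<in>{1..u}. 4)"
    by (intro sum.cong refl, subst card_image) (auto simp: inj_on_def)
  finally have A: "card ?A = 4 * u" by simp
  have "card ?B = (\<Sum>m\<in>{1..s}. card (VS m ` {1..5 + 6 * card (S m)}))"
    by (rule card_UN_disjoint) auto
  also have "\<dots> = (\<Sum>m\<in>{1..s}. 5 + 6 * card (S m))"
    by (intro sum.cong refl, subst card_image) (auto simp: inj_on_def)
  finally have B: "card ?B = (\<Sum>m\<in>{1..s}. 5 + 6 * card (S m))" .
  have "card (?A \<union> ?B) = card ?A + card ?B" by (rule card_Un_disjoint) auto
  moreover have "card (?A \<union> ?B \<union> {VC 1, VC 2}) = card (?A \<union> ?B) + card {VC 1, VC 2}"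
    by (rule card_Un_disjoint) auto
  ultimately show ?thesis unfolding vertices_def A B by simp
qed

text \<open>Double counting of the pairs of a set and an element in it.\<close>

lemma sum_length_occ: "(\<Sum>i\<in>{1..u}. length (occ i)) = (\<Sum>m\<in>{1..s}. card (S m))"
proof -
  have "length (occ i) = (\<Sum>m\<in>{1..s}. if i \<in> S m then 1 else 0)" for i
    by (simp add: distinct_card[OF distinct_occ, symmetric] set_occ sum.If_cases Int_def)
  then have "(\<Sum>i\<in>{1..u}. length (occ i)) = (\<Sum>m\<in>{1..s}. \<Sum>i\<in>{1..u}. if i \<in> S m then 1 else 0)"
    by (simp only:) (rule sum.swap)
  also have "\<dots> = (\<Sum>m\<in>{1..s}. card (S m))"
  proof (rule sum.cong)
    fix m assume "m \<in> {1..s}"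
    then have "{1..u} \<inter> S m = S m" using subset_universe by blast
    then show "(\<Sum>i\<in>{1..u}. if i \<in> S m then 1 else 0) = card (S m)"
      by (simp add: sum.If_cases)
  qed simp
  finally show ?thesis .
qed

end

section \<open>The tour of a solution\<close>

locale simple_solution = simple_instance +
  fixes P :: "nat set \<times> nat set"
  assumes solution: "ssp_solution {1..u} (S ` {1..s}) P"
begin

text \<open>The row of the triples of element \<open>i\<close> that the cycle uses to traverse the set gadgets.\<close>

definition row :: "nat \<Rightarrow> bool" where
  "row i \<longleftrightarrow> i \<in> snd P"

text \<open>The second port starts the chain in row \<open>\<not> row i\<close>, whose triples are
  run through backward; the triples in row \<open>row i\<close> are left to the set gadgets.\<close>

definition element_part :: "nat \<Rightarrow> vertex list" where
  "element_part i = VU i 1 # port (row i) i # port (\<not> row i) i #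
     concat (map (\<lambda>m. let t = slot S (\<not> row i) m i in [vc m t, vb m t, va m t]) (occ i)) @ [VU i 4]"

text \<open>The forward triple in column \<open>j\<close>, that is, the one in the row chosen for
  the element there. Columns are counted from 0, positions from 1.\<close>

definition triple_of :: "nat \<Rightarrow> nat \<Rightarrow> nat" where
  "triple_of m j = (THE t. \<exists>i\<in>S m. t = slot S (row i) m i \<and> position (S m) i = Suc j)"

text \<open>In column \<open>j\<close> the upper triple has number \<open>j\<close> and the lower
  one \<open>j + card (S m)\<close>.\<close>

definition lower :: "nat \<Rightarrow> nat \<Rightarrow> bool" where
  "lower m j \<longleftrightarrow> triple_of m j \<noteq> j"

text \<open>A column behind which the path changes rows; the three vertices \<open>VS m 3\<close>,
  \<open>VS m 4\<close> and \<open>VS m 5\<close> are inserted there.\<close>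

definition bridge_at :: "nat \<Rightarrow> nat" where
  "bridge_at m = (SOME j. Suc j < card (S m) \<and> lower m j \<noteq> lower m (Suc j))"

text \<open>\<open>VS m 5\<close> is attached to the lower row and \<open>VS m 3\<close> to the
  upper one, so the row that is left decides the direction of the inserted path.\<close>

definition set_step :: "nat \<Rightarrow> nat \<Rightarrow> vertex list" where
  "set_step m j = (let t = triple_of m j in [va m t, vb m t, vc m t]) @
     (if j \<noteq> bridge_at m then []
      else if lower m j then [VS m 5, VS m 4, VS m 3] else [VS m 3, VS m 4, VS m 5])"

definition set_part :: "nat \<Rightarrow> vertex list" where
  "set_part m = VS m 1 # concat (map (set_step m) [0..<card (S m)]) @ [VS m 2]"

definition tour :: "vertex list" where
  "tour = concat (map element_part [1..<Suc u]) @ VC 1 # concat (map set_part [1..<Suc s]) @ [VC 2]"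

text \<open>Injectivity of positions justifies the definite description in
  \<open>triple_of\<close>.\<close>

lemma triple_of_slot:
  assumes "m \<in> {1..s}" "i \<in> S m"
  shows "triple_of m (position (S m) i - 1) = slot S (row i) m i"
proof -
  have "1 \<le> position (S m) i" using position_bounds[OF finite_set] assms by blast
  moreover have "i' = i" if "i' \<in> S m" "position (S m) i' = position (S m) i" for i'
    using inj_on_position[OF finite_set[OF assms(1)]] that assms(2) by (simp add: inj_on_eq_iff)
  ultimately show ?thesis
    unfolding triple_of_def using assms(2) by (intro the_equality) auto
qed

lemma element_at:
  assumes "m \<in> {1..s}" "j < card (S m)"
  obtains i where "i \<in> S m" "position (S m) i = Suc j"
    "triple_of m j = (if row i then card (S m) else 0) + j" "lower m j \<longleftrightarrow> row i"
proof -
  have "Suc j \<in> position (S m) ` S m"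
    using assms position_image[OF finite_set[OF assms(1)]] by auto
  then obtain i where i: "i \<in> S m" "position (S m) i = Suc j" by auto
  then have "triple_of m j = (if row i then card (S m) else 0) + j"
    using triple_of_slot[OF assms(1) i(1)] by (simp add: slot_def)
  moreover from this have "lower m j \<longleftrightarrow> row i"
    using assms(2) by (auto simp: lower_def)
  ultimately show thesis using that i by blast
qed

lemma triple_of_cases:
  assumes "m \<in> {1..s}" "j < card (S m)"
  shows "triple_of m j = (if lower m j then j + card (S m) else j)"
  using element_at[OF assms] by (metis add.commute add_0)

text \<open>A split set has elements in both parts, hence columns of both rows. If no two
  neighbouring columns differed, induction would make all of them agree with column 0.\<close>

lemma bridge_at:
  assumes m: "m \<in> {1..s}"
  shows "Suc (bridge_at m) < card (S m)" "lower m (bridge_at m) \<noteq> lower m (Suc (bridge_at m))"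
proof -
  let ?k = "card (S m)"
  have split: "\<not> S m \<subseteq> fst P" "\<not> S m \<subseteq> snd P" "fst P \<union> snd P = {1..u}" "fst P \<inter> snd P = {}"
    using solution m by (auto simp: ssp_solution_def splits_def two_partition_def)
  have lower_pos: "lower m (position (S m) i - 1) \<longleftrightarrow> row i" "position (S m) i - 1 < ?k" if "i \<in> S m" for i
  proof -
    have pos: "1 \<le> position (S m) i" "position (S m) i \<le> ?k"
      using position_bounds[OF finite_set] m that by blast+
    then show "position (S m) i - 1 < ?k" by simp
    show "lower m (position (S m) i - 1) \<longleftrightarrow> row i"
      using triple_of_slot[OF m that] pos unfolding lower_def by (auto simp: slot_def)
  qed
  obtain i where "i \<in> S m" "\<not> row i" using split unfolding row_def by blast
  moreover obtain i' where "i' \<in> S m" "row i'"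
    using split subset_universe[OF m] unfolding row_def by blast
  ultimately obtain j j' where j: "j < ?k" "j' < ?k" "\<not> lower m j" "lower m j'"
    using lower_pos by metis
  have "\<exists>j. Suc j < ?k \<and> lower m j \<noteq> lower m (Suc j)"
  proof (rule ccontr)
    assume *: "\<not> ?thesis"
    have "lower m l \<longleftrightarrow> lower m 0" if "l < ?k" for l
      using that
    proof (induction l)
      case (Suc l)
      then show ?case using * by (metis Suc_lessD)
    qed simp
    then show False using j by blast
  qed
  then have "Suc (bridge_at m) < ?k \<and> lower m (bridge_at m) \<noteq> lower m (Suc (bridge_at m))"
    unfolding bridge_at_def by (rule someI_ex)
  then show "Suc (bridge_at m) < ?k" "lower m (bridge_at m) \<noteq> lower m (Suc (bridge_at m))" by auto
qed


lemma walk_element_part: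
  assumes i: "i \<in> {1..u}"
  shows "walk E (VU i 1) (element_part i) (VU i 4)"
proof -
  let ?r = "\<not> row i"
  let ?t = "\<lambda>q. slot S ?r (occ i ! q) i"
  let ?f = "\<lambda>q. [vc (occ i ! q) (?t q), vb (occ i ! q) (?t q), va (occ i ! q) (?t q)]"
  obtain n where n: "length (occ i) = Suc n"
    using occ_nonempty[OF i] by (cases "occ i") auto
  have "walk E (vc (occ i ! 0) (?t 0)) (concat (map ?f [0..<Suc n])) (va (occ i ! n) (?t n))"
  proof (rule walk_concat)
    fix q assume "q < Suc n"
    then have "occ i ! q \<in> {1..s}" "?t q < 2 * card (S (occ i ! q))"
      using nth_occ[of q i] slot_less n by auto
    then show "walk E (vc (occ i ! q) (?t q)) (?f q) (va (occ i ! q) (?t q))"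
      using set_arcs(3)[of "occ i ! q" "?t q"] by (auto simp: walk_simps)
  next
    fix q assume "Suc q < Suc n"
    then show "(va (occ i ! q) (?t q), vc (occ i ! Suc q) (?t (Suc q))) \<in> E"
      using element_arcs(5)[OF i] n by simp
  qed
  moreover have "map ?f [0..<Suc n] = map (\<lambda>m. let t = slot S ?r m i in [vc m t, vb m t, va m t]) (occ i)"
    unfolding n[symmetric] by (rule nth_equalityI) (simp_all add: Let_def)
  moreover have "last (occ i) = occ i ! n"
    using last_conv_nth[OF occ_nonempty[OF i]] n by simp
  ultimately have chain: "walk E (vc (occ i ! 0) (?t 0))
      (concat (map (\<lambda>m. let t = slot S ?r m i in [vc m t, vb m t, va m t]) (occ i)))
      (va (last (occ i)) (slot S ?r (last (occ i)) i))"
    by (simp only:)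
  show ?thesis
    unfolding element_part_def
    by (rule walk_Cons[OF element_arcs(1)[OF i] walk_Cons[OF element_arcs(2)[OF i]
            walk_Cons[OF element_arcs(3)[OF i] walk_append[OF chain element_arcs(4)[OF i] walk_singleton]]]])
qed

lemma walk_set_part:
  assumes m: "m \<in> {1..s}"
  shows "walk E (VS m 1) (set_part m) (VS m 2)"
proof -
  let ?k = "card (S m)" and ?J = "bridge_at m"
  \<comment> \<open>The last vertex of \<open>set_step m j\<close>.\<close>
  let ?b = "\<lambda>j. if j \<noteq> ?J then vc m (triple_of m j) else if lower m j then VS m 3 else VS m 5"
  note tri = triple_of_cases[OF m]
  obtain n where n: "?k = Suc n" using card_ge_2[OF m] by (cases ?k) auto
  have steps: "walk E (va m (triple_of m 0)) (concat (map (set_step m) [0..<Suc n])) (?b n)"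
  proof (rule walk_concat[where a = "\<lambda>j. va m (triple_of m j)"])
    fix j assume j: "j < Suc n"
    have "triple_of m j < 2 * ?k" using tri[of j] j n by (auto split: if_splits)
    then have w: "walk E (va m (triple_of m j))
      [va m (triple_of m j), vb m (triple_of m j), vc m (triple_of m j)] (vc m (triple_of m j))"
      using set_arcs(3)[OF m, of "triple_of m j"] by (auto simp: walk_simps)
    have "walk E (va m (triple_of m j)) (set_step m j) (if lower m j then VS m 3 else VS m 5)"
      if "j = ?J"
    proof -
      have "Suc j < ?k" using bridge_at[OF m] that by simp
      then show ?thesis
        using that w set_arcs(5)[OF m, of j] set_arcs(6)[OF m] tri[of j]
        by (cases "lower m j") (auto simp: set_step_def walk_simps Let_def)
    qed
    then show "walk E (va m (triple_of m j)) (set_step m j) (?b j)"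
      using w by (auto simp: set_step_def Let_def)
  next
    fix j assume "Suc j < Suc n"
    then have j: "Suc j < ?k" using n by simp
    show "(?b j, va m (triple_of m (Suc j))) \<in> E"
    proof (cases "j = ?J")
      case True
      then show ?thesis
        using set_arcs(5)[OF m j] tri[OF j] bridge_at(2)[OF m] by auto
    next
      case False
      then show ?thesis
        using set_arcs(4)[OF m j] tri[OF j] tri[OF Suc_lessD[OF j]] by auto
    qed
  qed
  \<comment> \<open>The bridge never comes behind the last column, so the path can leave for
    \<open>VS m 2\<close>.\<close>
  have last: "?b n = vc m (triple_of m n)" using bridge_at(1)[OF m] n by auto
  have "(VS m 1, va m (triple_of m 0)) \<in> E"
    using set_arcs(1)[OF m] tri[of 0] n by auto
  moreover have "(vc m (triple_of m n), VS m 2) \<in> E"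
    using set_arcs(2)[OF m] tri[of n] n by auto
  ultimately show ?thesis
    unfolding set_part_def n
    by (intro walk_Cons[OF _ walk_append[OF steps[unfolded last] _ walk_singleton]])
qed

lemma walk_tour: "walk E (VU 1 1) tour (VC 2)"
  unfolding tour_def
proof (rule walk_append[OF _ _ walk_Cons[OF _ walk_append[OF _ _ walk_singleton]]])
  have s: "1 \<le> s" using covered[of 1] universe_nonempty by auto
  show "walk E (VU 1 1) (concat (map element_part [1..<Suc u])) (VU u 4)"
    using linking_arcs(5) universe_nonempty walk_element_part by (intro walk_concat_from_1) auto
  show "walk E (VS 1 1) (concat (map set_part [1..<Suc s])) (VS s 2)"
    using linking_arcs(6) s walk_set_part by (intro walk_concat_from_1) auto
qed (fact linking_arcs)+

section \<open>Counting the visits of the tour\<close>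

lemma length_element_part: "length (element_part i) = 4 + 3 * length (occ i)"
  by (simp add: element_part_def length_concat comp_def Let_def sum_list_triv)

lemma length_set_part:
  assumes "m \<in> {1..s}"
  shows "length (set_part m) = 5 + 3 * card (S m)"
proof -
  have "(\<Sum>j<card (S m). length (set_step m j)) =
      (\<Sum>j<card (S m). 3 + (if j = bridge_at m then 3 else 0))"
    by (intro sum.cong) (auto simp: set_step_def Let_def)
  \<comment> \<open>\<open>bridge_at m\<close> is one of the columns, so the extra 3 occurs exactly
    once.\<close>
  also have "\<dots> = 3 * card (S m) + 3"
    using bridge_at(1)[OF assms] by (simp only: sum.distrib sum.delta) auto
  finally have "(\<Sum>j<card (S m). length (set_step m j)) = 3 * card (S m) + 3" .
  then show ?thesis
    by (simp add: set_part_def length_concat comp_def interv_sum_list_conv_sum_set_nat lessThan_atLeast0)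
qed

text \<open>For each set with \<open>k\<close> elements, the set part visits \<open>k\<close> of the
  \<open>2 * k\<close> triples; the element parts together visit the others, which
  \<open>sum_length_occ\<close> adds up.\<close>

lemma length_tour: "length tour = card (vertices u s S)"
proof -
  have I: "{1..<Suc n} = {1..n}" for n by auto
  have "length tour = (\<Sum>i\<in>{1..u}. length (element_part i)) + (\<Sum>m\<in>{1..s}. length (set_part m)) + 2"
    by (simp only: tour_def length_append length_Cons length_concat map_map comp_def
        interv_sum_list_conv_sum_set_nat set_upt I) simp
  also have "(\<Sum>i\<in>{1..u}. length (element_part i)) = 4 * u + 3 * (\<Sum>m\<in>{1..s}. card (S m))"
    by (simp only: length_element_part sum.distrib sum_distrib_left[symmetric] sum_length_occ) simp
  also have "(\<Sum>m\<in>{1..s}. length (set_part m)) = (\<Sum>m\<in>{1..s}. 5 + 3 * card (S m))"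
    by (intro sum.cong refl length_set_part)
  finally show ?thesis
    by (simp add: card_vertices sum.distrib sum_distrib_left[symmetric])
qed


lemma vertices_subset_tour: "vertices u s S \<subseteq> set tour"
proof
  fix x assume x: "x \<in> vertices u s S"
  have el: "set (element_part i) \<subseteq> set tour" if "i \<in> {1..u}" for i
    using that by (auto simp: tour_def simp del: upt_Suc)
  have st: "set (set_part m) \<subseteq> set tour" if "m \<in> {1..s}" for m
    using that by (auto simp: tour_def simp del: upt_Suc)
  have tr: "{va m j, vb m j, vc m j} \<subseteq> set tour" if m: "m \<in> {1..s}" and j: "j < 2 * card (S m)" for m j
  proof -
    let ?k = "card (S m)"
    obtain i r where i: "i \<in> S m" "slot S r m i = j"
    proof (cases "j < ?k")
      case True
      then show thesis using slot_surj[OF m True] that by (metis add_0)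
    next
      case False
      then have "j - ?k < ?k" using j by simp
      then obtain i where "i \<in> S m" "slot S True m i = ?k + (j - ?k)"
        using slot_surj[OF m] by metis
      then show thesis using that[of i True] False by simp
    qed
    show ?thesis
    \<comment> \<open>A triple in the chosen row occurs in the set part, any other in the chain of
      its element.\<close>
    proof (cases "r = row i")
      case True
      let ?l = "position (S m) i - 1"
      have "?l < ?k" using position_bounds[OF finite_set[OF m] i(1)] by auto
      then have "set (set_step m ?l) \<subseteq> set (set_part m)" by (auto simp: set_part_def)
      moreover have "{va m j, vb m j, vc m j} \<subseteq> set (set_step m ?l)"
        using triple_of_slot[OF m i(1)] i(2) True by (auto simp: set_step_def Let_def)
      ultimately show ?thesis using st[OF m] by blast
    next
      case False
      then have "r = (\<not> row i)" by simp
      then have "{va m j, vb m j, vc m j} \<subseteq> set (element_part i)"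
        using i m set_occ[of i] by (auto simp: element_part_def Let_def)
      then show ?thesis using el[of i] subset_universe[OF m] i(1) by blast
    qed
  qed
  show "x \<in> set tour"
  proof (cases x)
    case (VU i l)
    then have i: "i \<in> {1..u}" "l \<in> {1, 2, 3, 4}" using x by auto
    have "VU i l \<in> set (element_part i)"
      using i(2) by (cases "row i") (auto simp: element_part_def port_def)
    then show ?thesis using el[OF i(1)] VU by blast
  next
    case (VS m l)
    then have m: "m \<in> {1..s}" and l: "1 \<le> l" "l \<le> 5 + 6 * card (S m)" using x by auto
    show ?thesis
    proof (cases "l < 6")
      case True
      then have "l \<in> {1, 2} \<or> l \<in> {3, 4, 5}" using l by auto
      moreover have "{VS m 3, VS m 4, VS m 5} \<subseteq> set (set_step m (bridge_at m))"
        by (auto simp: set_step_def)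
      moreover have "set (set_step m (bridge_at m)) \<subseteq> set (set_part m)"
        using bridge_at(1)[OF m] by (auto simp: set_part_def)
      moreover have "{VS m 1, VS m 2} \<subseteq> set (set_part m)" by (auto simp: set_part_def)
      ultimately show ?thesis using st[OF m] VS by blast
    next
      case False
      \<comment> \<open>From number 6 on, the quotient by 3 is the triple and the remainder tells
        \<open>va\<close>, \<open>vb\<close> and \<open>vc\<close> apart.\<close>
      define j where "j = (l - 6) div 3"
      have "l = 6 + 3 * j \<or> l = 7 + 3 * j \<or> l = 8 + 3 * j" "j < 2 * card (S m)"
        using False l unfolding j_def by presburger+
      then have "x \<in> {va m j, vb m j, vc m j}" using VS by (auto simp: va_def vb_def vc_def)
      then show ?thesis using tr[OF m] \<open>j < 2 * card (S m)\<close> by blast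
    qed
  next
    case (VC l)
    then show ?thesis using x by (auto simp: tour_def)
  qed
qed

text \<open>\<open>card (set tour)\<close> lies between the number of vertices and the length of the
  tour, which agree.\<close>

lemma tour_correct: "set tour = vertices u s S" "distinct tour"
proof -
  have "card (set tour) = card (vertices u s S)"
    using card_length[of tour] card_mono[OF _ vertices_subset_tour] length_tour by simp
  then show "set tour = vertices u s S"
    using vertices_subset_tour card_subset_eq[of "set tour" "vertices u s S"] by simp
  show "distinct tour"
    using \<open>card (set tour) = _\<close> length_tour by (intro card_distinct) simp
qed

lemma hamiltonian_cycle_tour: "hamiltonian_cycle \<Gamma> (zip tour (rotate1 tour))"
  using tour_correct closed_walk_arcs[OF walk_tour linking_arcs(4)] walk_tour
  by (intro hamiltonian_cycleI) (auto simp: walk_def)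

lemma corresponding_pair_tour: "corresponding_pair u (zip tour (rotate1 tour)) = P"
proof -
  let ?p = "zip tour (rotate1 tour)"
  interpret cycle_arcs u s S "set ?p"
    by (rule cycle_arcs_of_cycle[OF hamiltonian_cycle_tour])
  have arc: "(port (row i) i, port (\<not> row i) i) \<in> set ?p" if "i \<in> {1..u}" for i
  proof -
    have "i \<in> set [1..<Suc u]" using that by auto
    then obtain us vs where us: "[1..<Suc u] = us @ i # vs" by (meson split_list)
    \<comment> \<open>In front of the two ports come the parts of all smaller elements and
      \<open>VU i 1\<close>.\<close>
    have "\<exists>xs ys. tour = xs @ port (row i) i # port (\<not> row i) i # ys"
      unfolding tour_def us
      by (rule exI[of _ "concat (map element_part us) @ [VU i 1]"]) (auto simp: element_part_def[of i] simp del: upt_Suc)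
    then show ?thesis using consecutive_in_zip_rotate1 by metis
  qed
  have "fst P \<union> snd P = {1..u}" "fst P \<inter> snd P = {}"
    using solution by (auto simp: ssp_solution_def two_partition_def)
  then have "fst P = {i\<in>{1..u}. \<not> row i}" "snd P = {i\<in>{1..u}. row i}"
    unfolding row_def by blast+
  moreover have "(port False i, port True i) \<in> set ?p \<longleftrightarrow> \<not> row i"
    "(port True i, port False i) \<in> set ?p \<longleftrightarrow> row i" if "i \<in> {1..u}" for i
    using arc[OF that] no_two_cycle by (cases "row i"; auto)+
  ultimately show ?thesis
    unfolding corresponding_pair_conv[OF hamiltonian_cycle_tour] by (auto simp: prod_eq_iff)
qed

end


section \<open>Identifying the pair in polynomial time\<close>

text \<open>An upper bound composes without the exact cost of the branch taken.\<close>

definition exec_within :: "prog \<Rightarrow> store \<Rightarrow> nat \<Rightarrow> store \<Rightarrow> bool" where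
  "exec_within c \<sigma> T \<tau> \<longleftrightarrow> (\<exists>t\<le>T. exec c \<sigma> t \<tau>)"

lemma exec_within_mono: "exec_within c \<sigma> T \<tau> \<Longrightarrow> T \<le> T' \<Longrightarrow> exec_within c \<sigma> T' \<tau>"
  unfolding exec_within_def using order_trans by blast

lemma exec_within_skip: "exec_within Skip \<sigma> 1 \<sigma>"
  unfolding exec_within_def using exec.skip by blast

lemma exec_within_put:
  "exec_within (Put x e e') \<sigma> (1 + cost_expr e + cost_expr e')
     (\<sigma>(x := (\<sigma> x)(eval_expr e \<sigma> := eval_expr e' \<sigma>)))"
  unfolding exec_within_def using exec.put by blast

lemma exec_within_seq:
  assumes "exec_within c \<sigma> T \<tau>" "exec_within c' \<tau> T' \<rho>"
  shows "exec_within (Seq c c') \<sigma> (1 + T + T') \<rho>"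
proof -
  obtain t t' where "t \<le> T" "exec c \<sigma> t \<tau>" "t' \<le> T'" "exec c' \<tau> t' \<rho>"
    using assms by (auto simp: exec_within_def)
  moreover from this have "exec (Seq c c') \<sigma> (1 + t + t') \<rho>" by (intro exec.seq)
  ultimately show ?thesis
    unfolding exec_within_def by (intro exI[of _ "1 + t + t'"]) auto
qed

lemma exec_within_cond:
  assumes "eval_test b \<sigma> \<Longrightarrow> exec_within c \<sigma> T \<tau>" "\<not> eval_test b \<sigma> \<Longrightarrow> exec_within c' \<sigma> T \<tau>"
  shows "exec_within (Cond b c c') \<sigma> (1 + cost_test b + T) \<tau>"
proof (cases "eval_test b \<sigma>")
  case True
  then obtain t where "t \<le> T" "exec c \<sigma> t \<tau>" using assms by (auto simp: exec_within_def)
  moreover from this have "exec (Cond b c c') \<sigma> (1 + cost_test b + t) \<tau>"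
    using True by (intro exec.cond_true)
  ultimately show ?thesis
    unfolding exec_within_def by (intro exI[of _ "1 + cost_test b + t"]) auto
next
  case False
  then obtain t where "t \<le> T" "exec c' \<sigma> t \<tau>" using assms by (auto simp: exec_within_def)
  moreover from this have "exec (Cond b c c') \<sigma> (1 + cost_test b + t) \<tau>"
    using False by (intro exec.cond_false)
  ultimately show ?thesis
    unfolding exec_within_def by (intro exI[of _ "1 + cost_test b + t"]) auto
qed

text \<open>\<open>\<sigma> j\<close> is the store after \<open>j\<close> rounds, so the loop
  invariant is an explicit sequence of stores; the factor \<open>Suc n\<close> also pays for the
  final failing test.\<close>

lemma exec_within_while:
  assumes "\<And>j. j < n \<Longrightarrow> eval_test b (\<sigma> j)" "\<not> eval_test b (\<sigma> n)"
    and "\<And>j. j < n \<Longrightarrow> exec_within c (\<sigma> j) T (\<sigma> (Suc j))"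
  shows "exec_within (While b c) (\<sigma> 0) (Suc n * (1 + cost_test b + T)) (\<sigma> n)"
  using assms
proof (induction n arbitrary: \<sigma>)
  case 0
  then have "exec (While b c) (\<sigma> 0) (1 + cost_test b) (\<sigma> 0)"
    by (intro exec.while_false)
  then show ?case
    unfolding exec_within_def by (intro exI[of _ "1 + cost_test b"]) auto
next
  case (Suc n)
  have "exec_within (While b c) (\<sigma> (Suc 0)) (Suc n * (1 + cost_test b + T)) (\<sigma> (Suc n))"
    using Suc.IH[of "\<lambda>j. \<sigma> (Suc j)"] Suc.prems by simp
  then obtain t' where t': "t' \<le> Suc n * (1 + cost_test b + T)"
      "exec (While b c) (\<sigma> (Suc 0)) t' (\<sigma> (Suc n))"
    by (auto simp: exec_within_def)
  obtain t where t: "t \<le> T" "exec c (\<sigma> 0) t (\<sigma> (Suc 0))"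
    using Suc.prems(3)[of 0] by (auto simp: exec_within_def)
  have "exec (While b c) (\<sigma> 0) (1 + cost_test b + t + t') (\<sigma> (Suc n))"
    using Suc.prems(1)[of 0] t(2) t'(2) by (intro exec.while_true) auto
  then show ?case
    unfolding exec_within_def using t(1) t'(1) by (intro exI conjI) auto
qed

section \<open>The program and its running time\<close>

definition pointer :: expr where "pointer = Get 2 (Const 0)"
definition counter :: expr where "counter = Get 3 (Const 0)"

text \<open>A set is encoded as its cardinality followed by its elements, so the entry at the
  pointer tells how far to jump.\<close>

definition skip_sets :: prog where
  "skip_sets =
     While (Less (Const 0) counter)
       (Seq (Put 2 (Const 0) (Add (Add pointer (Const 1)) (Get 0 pointer)))
            (Put 3 (Const 0) (Sub counter (Const 1))))"

text \<open>The vertex \<open>VU i 2\<close> is recognised by tag 0 and number 2. Its successor on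
  the cycle is \<open>VU i 3\<close>, with tag 0, or a vertex of a set gadget, with tag 1;
  subtracting the tag from 2 gives the number of the part containing \<open>i\<close>.\<close>

definition scan_vertex :: prog where
  "scan_vertex =
     Cond (Eq (Get 0 pointer) (Const 0))
       (Cond (Eq (Get 0 (Add pointer (Const 2))) (Const 2))
         (Put 1 (Get 0 (Add pointer (Const 1)))
            (Sub (Const 2) (Get 0 (Add pointer (Const 3)))))
         Skip)
       Skip"

definition scan_cycle :: prog where
  "scan_cycle =
     While (Less (Const 0) counter)
       (Seq scan_vertex
         (Seq (Put 2 (Const 0) (Add pointer (Const 3)))
              (Put 3 (Const 0) (Sub counter (Const 1)))))"

text \<open>The input says nothing behind the last vertex, so the tag of the first vertex is copied there:
  the successor of the last vertex is then found like all the others.\<close>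

definition identify_pair :: prog where
  "identify_pair =
     Seq (Put 2 (Const 0) (Const 2)) (Seq (Put 3 (Const 0) (Get 0 (Const 1))) (Seq skip_sets
     (Seq (Put 3 (Const 0) (Get 0 pointer)) (Seq (Put 2 (Const 0) (Add pointer (Const 1)))
     (Seq (Put 0 (Add (Add (Add pointer counter) counter) counter) (Get 0 pointer))
        scan_cycle)))))"

text \<open>Common shape of all stores in a run: the input in array 0, the output in array 1, and
  arrays 2 and 3 used at index 0 only, as pointer and counter.\<close>

definition memory :: "(nat \<Rightarrow> nat) \<Rightarrow> (nat \<Rightarrow> nat) \<Rightarrow> nat \<Rightarrow> nat \<Rightarrow> store" where
  "memory A r m k = (\<lambda>x n. if x = 0 then A n else if x = 1 then r n
     else if x = 2 \<and> n = 0 then m else if x = 3 \<and> n = 0 then k else 0)"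

lemma memory_simps [simp]:
  "memory A r m k 0 = A" "memory A r m k (Suc 0) = r"
  "memory A r m k 2 0 = m" "memory A r m k 3 0 = k"
  by (auto simp: memory_def fun_eq_iff)

lemma memory_updates:
  "(memory A r m k)(0 := A') = memory A' r m k"
  "(memory A r m k)(Suc 0 := r') = memory A r' m k"
  "(memory A r m k)(2 := (memory A r m k 2)(0 := n)) = memory A r n k"
  "(memory A r m k)(3 := (memory A r m k 3)(0 := n)) = memory A r m n"
  by (auto simp: memory_def fun_eq_iff)

lemma eval_pointer_counter [simp]:
  "eval_expr pointer (memory A r m k) = m" "eval_expr counter (memory A r m k) = k"
  "cost_expr pointer = 2" "cost_expr counter = 2"
  by (auto simp: pointer_def counter_def)

lemma initial_store_conv_memory:
  "initial_store xs = memory (\<lambda>n. if n < length xs then xs ! n else 0) (\<lambda>_. 0) 0 0"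
  by (auto simp: initial_store_def memory_def fun_eq_iff)

lemma put_memory:
  assumes "\<sigma> = memory A r m k"
  shows "eval_expr e \<sigma> = i \<Longrightarrow> eval_expr e' \<sigma> = n \<Longrightarrow> 1 + cost_expr e + cost_expr e' \<le> T \<Longrightarrow>
      exec_within (Put 0 e e') \<sigma> T (memory (A(i := n)) r m k)"
    and "eval_expr e \<sigma> = i \<Longrightarrow> eval_expr e' \<sigma> = n \<Longrightarrow> 1 + cost_expr e + cost_expr e' \<le> T \<Longrightarrow>
      exec_within (Put 1 e e') \<sigma> T (memory A (r(i := n)) m k)"
    and "eval_expr e' \<sigma> = n \<Longrightarrow> 2 + cost_expr e' \<le> T \<Longrightarrow>
      exec_within (Put 2 (Const 0) e') \<sigma> T (memory A r n k)"
    and "eval_expr e' \<sigma> = n \<Longrightarrow> 2 + cost_expr e' \<le> T \<Longrightarrow>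
      exec_within (Put 3 (Const 0) e') \<sigma> T (memory A r m n)"
  using exec_within_put[of 0 e e' \<sigma>] exec_within_put[of 1 e e' \<sigma>]
    exec_within_put[of 2 "Const 0" e' \<sigma>] exec_within_put[of 3 "Const 0" e' \<sigma>]
  by (auto simp: assms memory_updates elim!: exec_within_mono)

text \<open>\<open>m j\<close> is the pointer after \<open>j\<close> sets. A round costs at most 17
  steps for the body and 5 for the test, within 23.\<close>

lemma exec_skip_sets:
  assumes "\<And>j. j < k \<Longrightarrow> m (Suc j) = m j + 1 + A (m j)"
  shows "exec_within skip_sets (memory A r (m 0) k) (Suc k * 23) (memory A r (m k) 0)"
proof -
  let ?\<sigma> = "\<lambda>j. memory A r (m j) (k - j)"
  let ?c = "Seq (Put 2 (Const 0) (Add (Add pointer (Const 1)) (Get 0 pointer)))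
    (Put 3 (Const 0) (Sub counter (Const 1)))"
  have "exec_within ?c (?\<sigma> j) 17 (?\<sigma> (Suc j))" if "j < k" for j
  proof -
    have "exec_within ?c (?\<sigma> j) (1 + (2 + 8) + (2 + 4)) (?\<sigma> (Suc j))"
      using assms[OF that]
      by (intro exec_within_seq[where \<tau> = "memory A r (m (Suc j)) (k - j)"] put_memory[OF refl]) auto
    then show ?thesis by simp
  qed
  then have "exec_within skip_sets (?\<sigma> 0) (Suc k * (1 + cost_test (Less (Const 0) counter) + 17)) (?\<sigma> k)"
    unfolding skip_sets_def by (intro exec_within_while) auto
  then show ?thesis by (rule_tac exec_within_mono) auto
qed

text \<open>The contents of array 1 after \<open>j\<close> vertices, whose codes of three numbers
  each start at address \<open>m\<close>.\<close>

primrec scan :: "(nat \<Rightarrow> nat) \<Rightarrow> nat \<Rightarrow> nat \<Rightarrow> nat \<Rightarrow> nat" where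
  "scan A m 0 = (\<lambda>_. 0)"
| "scan A m (Suc j) =
     (if A (m + 3 * j) = 0 \<and> A (m + 3 * j + 2) = 2
      then (scan A m j)(A (m + 3 * j + 1) := 2 - A (m + 3 * j + 3))
      else scan A m j)"

lemma exec_scan_vertex:
  "exec_within scan_vertex (memory A (scan A m j) (m + 3 * j) k) 30
     (memory A (scan A m (Suc j)) (m + 3 * j) k)"
proof -
  let ?\<sigma> = "memory A (scan A m j) (m + 3 * j) k"
  let ?\<tau> = "memory A (scan A m (Suc j)) (m + 3 * j) k"
  let ?put = "Put 1 (Get 0 (Add pointer (Const 1))) (Sub (Const 2) (Get 0 (Add pointer (Const 3))))"
  have skip: "exec_within Skip ?\<sigma> 13 ?\<tau>"
    if "\<not> (A (m + 3 * j) = 0 \<and> A (m + 3 * j + 2) = 2)"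
  proof -
    have "scan A m (Suc j) = scan A m j" using that by auto
    then show ?thesis using exec_within_mono[OF exec_within_skip, of 13 ?\<sigma>] by simp
  qed
  have put: "exec_within ?put ?\<sigma> 13 ?\<tau>" if "A (m + 3 * j) = 0" "A (m + 3 * j + 2) = 2"
  proof -
    have "scan A m (Suc j) = (scan A m j)(A (m + 3 * j + 1) := 2 - A (m + 3 * j + 3))"
      using that by simp
    then show ?thesis
      by (simp only:) (rule put_memory[OF refl]; simp)
  qed
  have "exec_within scan_vertex ?\<sigma> (1 + cost_test (Eq (Get 0 pointer) (Const 0)) +
      (1 + cost_test (Eq (Get 0 (Add pointer (Const 2))) (Const 2)) + 13)) ?\<tau>"
    unfolding scan_vertex_def
  proof (rule exec_within_cond)
    assume "eval_test (Eq (Get 0 pointer) (Const 0)) ?\<sigma>"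
    then show "exec_within (Cond (Eq (Get 0 (Add pointer (Const 2))) (Const 2)) ?put Skip) ?\<sigma>
      (1 + cost_test (Eq (Get 0 (Add pointer (Const 2))) (Const 2)) + 13) ?\<tau>"
      by (intro exec_within_cond put skip) simp_all
  next
    assume "\<not> eval_test (Eq (Get 0 pointer) (Const 0)) ?\<sigma>"
    then show "exec_within Skip ?\<sigma>
      (1 + cost_test (Eq (Get 0 (Add pointer (Const 2))) (Const 2)) + 13) ?\<tau>"
      by (intro exec_within_mono[OF skip]) simp_all
  qed
  then show ?thesis by (rule exec_within_mono) simp
qed

lemma exec_scan_cycle:
  "exec_within scan_cycle (memory A (\<lambda>_. 0) m k) (Suc k * 50) (memory A (scan A m k) (m + 3 * k) 0)"
proof -
  let ?\<sigma> = "\<lambda>j. memory A (scan A m j) (m + 3 * j) (k - j)"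
  let ?c = "Seq scan_vertex (Seq (Put 2 (Const 0) (Add pointer (Const 3)))
    (Put 3 (Const 0) (Sub counter (Const 1))))"
  have "exec_within ?c (?\<sigma> j) 44 (?\<sigma> (Suc j))" for j
  proof -
    have "exec_within ?c (?\<sigma> j) (1 + 30 + (1 + (2 + 4) + (2 + 4))) (?\<sigma> (Suc j))"
    proof (rule exec_within_seq[OF exec_scan_vertex exec_within_seq])
      show "exec_within (Put 2 (Const 0) (Add pointer (Const 3)))
        (memory A (scan A m (Suc j)) (m + 3 * j) (k - j)) (2 + 4)
        (memory A (scan A m (Suc j)) (m + 3 * Suc j) (k - j))"
        by (rule put_memory[OF refl]; simp)
      show "exec_within (Put 3 (Const 0) (Sub counter (Const 1)))
        (memory A (scan A m (Suc j)) (m + 3 * Suc j) (k - j)) (2 + 4) (?\<sigma> (Suc j))"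
        by (rule put_memory[OF refl]; simp)
    qed
    then show ?thesis by (rule exec_within_mono) simp
  qed
  then have "exec_within scan_cycle (?\<sigma> 0)
      (Suc k * (1 + cost_test (Less (Const 0) counter) + 44)) (?\<sigma> k)"
    unfolding scan_cycle_def by (intro exec_within_while) auto
  then show ?thesis by (rule_tac exec_within_mono) auto
qed

text \<open>\<open>m j\<close> is the address of the block of the set with number
  \<open>Suc j\<close>. Thus \<open>m s\<close> holds the length of the cycle and
  \<open>m s + 1\<close> is where its vertices begin.\<close>

lemma exec_identify_pair:
  assumes "A 1 = s" "m 0 = 2" "\<And>j. j < s \<Longrightarrow> m (Suc j) = m j + 1 + A (m j)"
    and "A (m s) = n" "A' = A(m s + 1 + 3 * n := A (m s + 1))"
  shows "exec_within identify_pair (memory A (\<lambda>_. 0) 0 0) (200 + s * 23 + n * 50)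
    (memory A' (scan A' (m s + 1) n) (m s + 1 + 3 * n) 0)"
proof -
  let ?M = "\<lambda>B i k. memory B (\<lambda>_. 0) i k"
  have "exec_within identify_pair (?M A 0 0)
     (1 + (2 + 1) + (1 + (2 + 2) + (1 + (Suc s * 23) + (1 + (2 + 3) + (1 + (2 + 4) +
       (1 + (1 + 11 + 3) + Suc n * 50)))))) (memory A' (scan A' (m s + 1) n) (m s + 1 + 3 * n) 0)"
    unfolding identify_pair_def
  proof (rule exec_within_seq[OF _ exec_within_seq[OF _ exec_within_seq[OF _ exec_within_seq[OF _
        exec_within_seq[OF _ exec_within_seq[OF _ exec_scan_cycle]]]]]])
    show "exec_within (Put 2 (Const 0) (Const 2)) (?M A 0 0) (2 + 1) (?M A (m 0) 0)"
      using assms(2) by (intro put_memory[OF refl]) auto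
    show "exec_within (Put 3 (Const 0) (Get 0 (Const 1))) (?M A (m 0) 0) (2 + 2) (?M A (m 0) s)"
      using assms(1) by (intro put_memory[OF refl]) auto
    show "exec_within skip_sets (?M A (m 0) s) (Suc s * 23) (?M A (m s) 0)"
      by (rule exec_skip_sets) fact
    show "exec_within (Put 3 (Const 0) (Get 0 pointer)) (?M A (m s) 0) (2 + 3) (?M A (m s) n)"
      using assms(4) by (intro put_memory[OF refl]) auto
    show "exec_within (Put 2 (Const 0) (Add pointer (Const 1))) (?M A (m s) n) (2 + 4) (?M A (m s + 1) n)"
      by (rule put_memory[OF refl]; simp)
    have "m s + 1 + n + n + n = m s + 1 + 3 * n" by simp
    then show "exec_within (Put 0 (Add (Add (Add pointer counter) counter) counter) (Get 0 pointer))
      (?M A (m s + 1) n) (1 + 11 + 3) (?M A' (m s + 1) n)"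
      unfolding assms(5) by (intro put_memory[OF refl]) auto
  qed
  then show ?thesis by (rule exec_within_mono) simp
qed

section \<open>Layout of the encoded input\<close>

lemma nth_concat:
  assumes "j < length xss" "r < length (xss ! j)"
  shows "length (concat (take j xss)) + r < length (concat xss)"
    and "concat xss ! (length (concat (take j xss)) + r) = xss ! j ! r"
proof -
  have "concat xss = concat (take j xss) @ xss ! j @ concat (drop (Suc j) xss)"
    using id_take_nth_drop[OF assms(1)] by (metis concat.simps(2) concat_append)
  then show "length (concat (take j xss)) + r < length (concat xss)"
    and "concat xss ! (length (concat (take j xss)) + r) = xss ! j ! r"
    using assms(2) by (simp_all add: nth_append)
qed

lemma length_encode_vertex [simp]: "length (encode_vertex x) = 3"
  by (cases x) auto

lemma nth_concat_encode_vertex: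
  assumes "j < length xs" "r < 3"
  shows "concat (map encode_vertex xs) ! (3 * j + r) = encode_vertex (xs ! j) ! r"
proof -
  have "length (concat (take j (map encode_vertex xs))) = 3 * j"
    using assms(1) by (simp add: length_concat take_map comp_def sum_list_triv)
  then show ?thesis
    using nth_concat(2)[of j "map encode_vertex xs" r] assms by simp
qed

text \<open>Cell \<open>i\<close> is written only at an occurrence of \<open>VU i 2\<close>, and
  position \<open>l\<close> is the only one.\<close>

lemma scan_correct:
  assumes A: "\<And>j r. j < length xs \<Longrightarrow> r < 3 \<Longrightarrow> A (b + 3 * j + r) = encode_vertex (xs ! j) ! r"
    and "distinct xs" "l < length xs" "xs ! l = VU i 2" "j \<le> length xs"
  shows "scan A b j i = (if l < j then 2 - A (b + 3 * l + 3) else 0)"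
  using assms(5)
proof (induction j)
  case (Suc j)
  then have j: "j < length xs" by simp
  have code: "A (b + 3 * j) = encode_vertex (xs ! j) ! 0" "A (b + 3 * j + 1) = encode_vertex (xs ! j) ! 1"
    "A (b + 3 * j + 2) = encode_vertex (xs ! j) ! 2"
    using A[OF j, of 0] A[OF j, of 1] A[OF j, of 2] by simp_all
  have eq: "xs ! j = VU i 2 \<longleftrightarrow> j = l"
    using assms(2-4) j by (metis nth_eq_iff_index_eq)
  have "scan A b (Suc j) i = (if j = l then 2 - A (b + 3 * l + 3) else scan A b j i)"
  proof (cases "xs ! j")
    case (VU i' m)
    then show ?thesis using code eq by (auto simp: numeral_2_eq_2)
  next
    case (VS m l)
    then show ?thesis using code eq by auto
  next
    case (VC m)
    then show ?thesis using code eq by auto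
  qed
  then show ?case using Suc by auto
qed simp

context simple_instance
begin

lemma exec_identify_pair_encode:
  fixes p
  defines "xs \<equiv> map fst p"
  assumes "distinct xs" "xs \<noteq> []"
  obtains \<tau> where
    "exec_within identify_pair (initial_store (encode_instance u s S @ encode_cycle p))
       (200 + s * 23 + length p * 50) \<tau>"
    "\<And>i l. l < length xs \<Longrightarrow> xs ! l = VU i 2 \<Longrightarrow>
       \<tau> 1 i = 2 - encode_vertex (xs ! (Suc l mod length xs)) ! 0"
proof -
  define bs where "bs = map (\<lambda>i. card (S i) # sorted_list_of_set (S i)) [1..<Suc s]"
  define I where "I = encode_instance u s S @ encode_cycle p"
  define A where "A = (\<lambda>n. if n < length I then I ! n else 0)"
  \<comment> \<open>The summand 2 skips \<open>u\<close> and \<open>s\<close>.\<close>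
  define m where "m j = 2 + length (concat (take j bs))" for j
  define n where "n = length xs"
  have n: "n = length p" "0 < n" using assms(3) by (auto simp: n_def xs_def)
  have I: "I = u # s # concat bs @ n # concat (map encode_vertex xs)"
    by (simp add: I_def encode_instance_def encode_cycle_def bs_def xs_def n_def)
  have len: "length bs = s" by (simp add: bs_def)
  have bs: "bs ! j = card (S (Suc j)) # sorted_list_of_set (S (Suc j))" if "j < s" for j
    using that by (simp add: bs_def del: upt_Suc)
  have len_I: "length I = m s + 1 + 3 * n"
    by (simp add: I m_def len length_concat comp_def sum_list_triv n_def)
  have A_m: "A (m j) = card (S (Suc j))" if "j < s" for j
  proof -
    have "length (concat (take j bs)) < length (concat bs)" "concat bs ! length (concat (take j bs)) = card (S (Suc j))"
      using nth_concat[of j bs 0] that len bs by auto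
    then show ?thesis by (simp add: A_def I m_def nth_append)
  qed
  have m_Suc: "m (Suc j) = m j + 1 + A (m j)" if "j < s" for j
    using that len bs[OF that] A_m[OF that] by (simp add: m_def take_Suc_conv_app_nth)
  have A_n: "A (m s) = n"
    by (simp add: A_def I m_def len nth_append)
  have A_vertex: "A (m s + 1 + 3 * j + r) = encode_vertex (xs ! j) ! r" if "j < n" "r < 3" for j r
  proof -
    have "I ! (m s + 1 + (3 * j + r)) = concat (map encode_vertex xs) ! (3 * j + r)"
      by (simp add: I m_def len nth_append)
    moreover have "m s + 1 + (3 * j + r) < length I" using that by (simp add: len_I)
    ultimately show ?thesis
      using nth_concat_encode_vertex[of j xs r] that by (simp add: A_def n_def add.assoc)
  qed
  let ?b = "m s + 1"
  \<comment> \<open>\<open>?b + 3 * n\<close> is the first address behind the input.\<close>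
  define A' where "A' = A(?b + 3 * n := A ?b)"
  have A'_vertex: "A' (?b + 3 * j + r) = encode_vertex (xs ! j) ! r" if "j < n" "r < 3" for j r
    using A_vertex[OF that] that by (simp add: A'_def)
  \<comment> \<open>For the last vertex the cyclic successor is the first one, whose tag is the
    copied cell.\<close>
  have A'_next: "A' (?b + 3 * l + 3) = encode_vertex (xs ! (Suc l mod n)) ! 0" if "l < n" for l
  proof (cases "Suc l = n")
    case True
    then have "?b + 3 * l + 3 = ?b + 3 * n" by simp
    moreover have "A ?b = encode_vertex (xs ! 0) ! 0" using A_vertex[of 0 0] n by simp
    ultimately show ?thesis using True by (simp add: A'_def)
  next
    case False
    then have "Suc l < n" using that by simp
    then show ?thesis using A'_vertex[of "Suc l" 0] by (simp add: algebra_simps)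
  qed
  define \<tau> where "\<tau> = memory A' (scan A' ?b n) (?b + 3 * n) 0"
  have "exec_within identify_pair (memory A (\<lambda>_. 0) 0 0) (200 + s * 23 + n * 50) \<tau>"
    unfolding \<tau>_def
    by (rule exec_identify_pair[of A s m])
      (use m_Suc A_n in \<open>auto simp: A_def I m_def A'_def\<close>)
  moreover have "memory A (\<lambda>_. 0) 0 0 = initial_store I"
    by (simp add: initial_store_conv_memory A_def)
  moreover have "\<tau> 1 i = 2 - encode_vertex (xs ! (Suc l mod length xs)) ! 0"
    if "l < length xs" "xs ! l = VU i 2" for i l
    using scan_correct[of xs A' ?b l i n] A'_vertex assms(2) that A'_next[of l]
    by (simp add: \<tau>_def n_def)
  ultimately show thesis using that[of \<tau>] n(1) by (simp add: I_def)
qed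

text \<open>The vertex count has coefficients 4, 5 and 6 at the three summands of the instance
  size.\<close>

lemma length_cycle_le:
  assumes "hamiltonian_cycle \<Gamma> p"
  shows "length p \<le> 6 * instance_size u s S + 2"
proof -
  have "length p = card (vertices u s S)"
    using cycleD(2,3)[OF assms] by (metis distinct_card length_map)
  then show ?thesis
    by (simp add: card_vertices instance_size_def sum.distrib sum_distrib_left[symmetric])
qed

text \<open>Inserting \<open>length_cycle_le\<close> into the bound for the run gives 200 + 2 * 50 =
  300 and 23 + 6 * 50 = 323.\<close>

lemma identify_pair_correct:
  assumes "hamiltonian_cycle \<Gamma> p"
  obtains \<tau> t where "exec identify_pair (initial_store (encode_instance u s S @ encode_cycle p)) t \<tau>"
    "t \<le> 300 + 323 * instance_size u s S" "output_pair u \<tau> = corresponding_pair u p"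
proof -
  note p = cycleD[OF assms]
  interpret cycle_arcs u s S "set p" by (rule cycle_arcs_of_cycle) fact
  let ?xs = "map fst p"
  have "VU 1 1 \<in> set ?xs" unfolding p(3) using universe_nonempty by simp
  then have "?xs \<noteq> []" by auto
  then obtain \<tau> where \<tau>: "exec_within identify_pair
        (initial_store (encode_instance u s S @ encode_cycle p)) (200 + s * 23 + length p * 50) \<tau>"
      "\<And>i l. l < length ?xs \<Longrightarrow> ?xs ! l = VU i 2 \<Longrightarrow>
        \<tau> 1 i = 2 - encode_vertex (?xs ! (Suc l mod length ?xs)) ! 0"
    using exec_identify_pair_encode[OF p(2)] by blast
  have out: "\<tau> 1 i = 2 - encode_vertex y ! 0" if y: "(port True i, y) \<in> set p" for i y
  proof -
    obtain l where l: "l < length p" "p ! l = (port True i, y)"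
      using iffD1[OF in_set_conv_nth y] by blast
    then have "?xs ! (Suc l mod length ?xs) = map snd p ! l"
      unfolding p(4) by (simp add: nth_rotate1)
    then show ?thesis using \<tau>(2)[of l i] l by (simp add: port_def)
  qed
  \<comment> \<open>The successor of \<open>port True i\<close> is the other port, with tag 0, or
    the first vertex of the chain, with tag 1.\<close>
  have val: "\<tau> 1 i = (if (port True i, port False i) \<in> set p then 2 else 1)"
    if i: "i \<in> {1..u}" for i
  proof -
    obtain y where y: "(port True i, y) \<in> set p" using out_exists[of "port True i"] i by auto
    then have "y = port False i \<or> y = vc (occ i ! 0) (slot S True (occ i ! 0) i)"
      using edge_from_port[of True i y] p(1) by auto
    then show ?thesis
    proof
      assume "y = port False i"
      then show ?thesis using y out[OF y] by (simp add: port_def)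
    next
      assume "y = vc (occ i ! 0) (slot S True (occ i ! 0) i)"
      then show ?thesis using y out[OF y] out_unique[OF y, of "port False i"] by (auto simp: vc_def)
    qed
  qed
  \<comment> \<open>Exactly one of the two arcs between the ports is in the cycle, so output 1
    stands for the opposite direction.\<close>
  have "\<tau> 1 i = 1 \<longleftrightarrow> (port False i, port True i) \<in> set p"
    "\<tau> 1 i = 2 \<longleftrightarrow> (port True i, port False i) \<in> set p" if "i \<in> {1..u}" for i
    using val[OF that] port_arc_exists[OF that] no_two_cycle by (auto simp: ex_bool_eq)
  then have "output_pair u \<tau> = corresponding_pair u p"
    unfolding corresponding_pair_conv[OF assms] output_pair_def by (intro arg_cong2[of _ _ _ _ Pair]) blast+
  moreover obtain t where "exec identify_pair (initial_store (encode_instance u s S @ encode_cycle p)) t \<tau>"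
    "t \<le> 200 + s * 23 + length p * 50"
    using \<tau>(1) by (auto simp: exec_within_def)
  moreover have "s \<le> instance_size u s S" by (simp add: instance_size_def)
  ultimately show thesis
    using that[of t \<tau>] length_cycle_le[OF assms] by simp
qed

end

lemma identifies_pair: "identifies_pair_in_time identify_pair [:300, 323:]"
  unfolding identifies_pair_in_time_def
proof (intro allI impI)
  fix u s S p assume "simple_form u s S" and p: "hamiltonian_cycle (ssp_graph u s S) p"
  then interpret simple_instance u s S by unfold_locales
  obtain \<tau> t where "exec identify_pair (initial_store (encode_instance u s S @ encode_cycle p)) t \<tau>"
    "t \<le> 300 + 323 * instance_size u s S" "output_pair u \<tau> = corresponding_pair u p"
    using identify_pair_correct[OF p] by blast
  then show "\<exists>t \<tau>. exec identify_pair (initial_store (encode_instance u s S @ encode_cycle p)) t \<tau> \<and>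
      t \<le> poly [:300, 323:] (instance_size u s S) \<and> output_pair u \<tau> = corresponding_pair u p"
    by (auto simp: mult.commute)
qed

theorem proposition1:
  shows
    "(\<forall>u s S. simple_form u s S \<longrightarrow>
        (\<nexists>P. ssp_solution {1..u} (S ` {1..s}) P) \<longrightarrow>
        \<not> hamiltonian (ssp_graph u s S)) \<and>
     (\<forall>u s S P. simple_form u s S \<longrightarrow>
        ssp_solution {1..u} (S ` {1..s}) P \<longrightarrow>
        (\<exists>p. hamiltonian_cycle (ssp_graph u s S) p \<and> corresponding_pair u p = P)) \<and>
     (\<exists>c q. identifies_pair_in_time c q) \<and>
     (\<forall>u s S p. simple_form u s S \<longrightarrow>
        hamiltonian_cycle (ssp_graph u s S) p \<longrightarrow>
        ssp_solution {1..u} (S ` {1..s}) (corresponding_pair u p))"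
proof (intro conjI)
  show sol: "\<forall>u s S p. simple_form u s S \<longrightarrow>
        hamiltonian_cycle (ssp_graph u s S) p \<longrightarrow>
        ssp_solution {1..u} (S ` {1..s}) (corresponding_pair u p)"
    using simple_instance.corresponding_pair_solution by (auto simp: simple_instance_def)
  \<comment> \<open>A Hamiltonian cycle would supply a solution, namely its corresponding
    pair.\<close>
  then show "\<forall>u s S. simple_form u s S \<longrightarrow>
        (\<nexists>P. ssp_solution {1..u} (S ` {1..s}) P) \<longrightarrow>
        \<not> hamiltonian (ssp_graph u s S)"
    unfolding hamiltonian_def by blast
  show "\<forall>u s S P. simple_form u s S \<longrightarrow>
        ssp_solution {1..u} (S ` {1..s}) P \<longrightarrow>
        (\<exists>p. hamiltonian_cycle (ssp_graph u s S) p \<and> corresponding_pair u p = P)"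
  proof (intro allI impI)
    fix u s S P assume "simple_form u s S" "ssp_solution {1..u} (S ` {1..s}) P"
    then interpret simple_solution u s S P by unfold_locales
    show "\<exists>p. hamiltonian_cycle (ssp_graph u s S) p \<and> corresponding_pair u p = P"
      using hamiltonian_cycle_tour corresponding_pair_tour by blast
  qed
  show "\<exists>c q. identifies_pair_in_time c q"
    using identifies_pair by blast
qed

end
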